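(* Let $G=\mathrm{Spin}(n)$, $\mathfrak g=\mathfrak{so}(n)$, and let $U$ be a manifold, $\bar g_{01}:U\to G$ (the map underlying a morphism $g_{01}:U\to\mathrm{String}(n)$), $A_{01}\in\Omega^1(U)$, $\omega^2_{01}\in\Omega^2(U)$, $\theta_0,\theta_1\in\Omega^1(U,\mathfrak g)$, $B_0,B_1\in\Omega^2(U)$ with $B_1-B_0=\omega^2_{01}+dA_{01}$, $\mathrm{cs}_3(\theta_1)-\mathrm{cs}_3(\theta_0)=d\omega^2_{01}$, $\theta_0-\mathrm{Ad}_{\bar g_{01}}\theta_1=-\bar g_{01}^*\theta_{MC}$ (i.e. a 1-simplex of $\mathrm{String}(n)$-principal bundles with connection over $U$). Then, with $\mu=\bar g_{01}^*\theta_{MC}$ and $$\beta_{01}(X)=\iota_X(dA_{01}+\omega^2_{01})+(\mu(X),\theta_0(\cdot))^{\mathfrak g}-(\mu(\cdot),\theta_0(X))^{\mathfrak g}-(\mu(X),\mu(\cdot))^{\mathfrak g},$$ the matrix $$\Lambda_{01}=\begin{pmatrix}1&0&0\\-\mu&\mathrm{Ad}_{\bar g_{01}}&0\\\beta_{01}&2\mu^\star\circ\mathrm{Ad}_{\bar g_{01}}&1\end{pmatrix}$$ is an inner automorphism of the standard transitive Courant algebroid $TU\oplus(U\times\mathfrak g)\oplus T^*U$.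
   Context: $\theta_{MC}$ is the right-invariant Maurer–Cartan form on $G$ ($d\theta_{MC}=\tfrac12[\theta_{MC},\theta_{MC}]$); $(-,-)^{\mathfrak g}$ a fixed nondegenerate invariant symmetric bilinear form on $\mathfrak g$; $\mathrm{cs}_3(\theta)=(\theta,d\theta)^{\mathfrak g}+\tfrac13(\theta,[\theta,\theta]_{\mathfrak g})^{\mathfrak g}$ (products of forms combined with wedge); $\phi^\star(a)(X)=(a,\phi(X))^{\mathfrak g}$; a 2-form $\omega$ is regarded as the map $X\mapsto\iota_X\omega$. $\mathrm{String}(n)$ is the string Lie 2-group extending $\mathrm{Spin}(n)$; only the underlying map $\bar g_{01}$ enters. Standard transitive Courant algebroid: anchor the projection to $TU$, pairing $\tfrac12(\xi(Y)+\eta(X))+(a,b)^{\mathfrak g}$, bracket $[X,Y]+X(b)-Y(a)+[a,b]_{\mathfrak g}+L_X\eta-\iota_Yd\xi+\mathcal P(a,b)$, $\mathcal P(a,b)(Y)=2(b,Y(a))^{\mathfrak g}$. Inner automorphism (in the sense of Ševera): an automorphism of the form $$\begin{pmatrix}1&0&0\\-g^*\theta_{MC}&\mathrm{Ad}_g&0\\\omega-(g^*\theta_{MC})^\star\circ g^*\theta_{MC}&2(g^*\theta_{MC})^\star\circ\mathrm{Ad}_g&1\end{pmatrix}$$ for a pair $(g,\omega)$ with $g:U\to G$ smooth and $\omega\in\Omega^2(U)$ satisfying $d\omega+g^*\mathfrak C=0$, where $\mathfrak C=\tfrac16(\theta_{MC},[\theta_{MC},\theta_{MC}]_{\mathfrak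 g})^{\mathfrak g}$, i.e. $\mathfrak C(\hat a,\hat b,\hat c)=(a,[b,c]_{\mathfrak g})^{\mathfrak g}$ on right-invariant vector fields. *)

theory Defs
  imports "HOL-Analysis.Analysis" "HOL-Library.Function_Algebras"
begin

text \<open>Sums, differences and products of functions, forms and sections are pointwise
  (\<open>Function_Algebras\<close>, product spaces).\<close>

section \<open>The Clifford algebra, \<open>Spin(n)\<close> and its Lie algebra\<close>

text \<open>The real Clifford algebra on \<open>n = CARD('n)\<close> anticommuting generators with square \<open>-1\<close>.
  The coordinate with index \<open>S\<close> belongs to the ordered product of the generators \<open>e i\<close>, \<open>i \<in> S\<close>.\<close>

type_synonym 'n cl = "real ^ 'n set"

text \<open>Sorting the concatenation of two ordered monomials costs one sign for each pair
  \<open>(s, t)\<close> with \<open>t < s\<close> and one (from \<open>e s * e s = -1\<close>) for each \<open>s = t\<close>.\<close>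

definition cl_sign :: "'n::{finite,linorder} set \<Rightarrow> 'n set \<Rightarrow> real" where
  "cl_sign S T = (-1) ^ card {(s, t). s \<in> S \<and> t \<in> T \<and> t \<le> s}"

definition cl_mult :: "'n::{finite,linorder} cl \<Rightarrow> 'n cl \<Rightarrow> 'n cl"  (infixl "\<odot>" 70) where
  "x \<odot> y = (\<Sum>S\<in>UNIV. \<Sum>T\<in>UNIV. (x $ S * y $ T * cl_sign S T) *\<^sub>R axis (sym_diff S T) 1)"

definition cl_one :: "'n::{finite,linorder} cl" where
  "cl_one = axis {} 1"

definition cl_inverse :: "'n::{finite,linorder} cl \<Rightarrow> 'n cl" where
  "cl_inverse x = (THE y. x \<odot> y = cl_one \<and> y \<odot> x = cl_one)"

definition cl_vec :: "real ^ 'n::{finite,linorder} \<Rightarrow> 'n cl" where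
  "cl_vec v = (\<Sum>i\<in>UNIV. (v $ i) *\<^sub>R axis {i} 1)"

text \<open>Products of an even number of unit vectors.\<close>

inductive_set spin_group :: "'n::{finite,linorder} cl set" where
  one: "cl_one \<in> spin_group"
| step: "g \<in> spin_group \<Longrightarrow> norm v = 1 \<Longrightarrow> norm w = 1 \<Longrightarrow> g \<odot> cl_vec v \<odot> cl_vec w \<in> spin_group"

text \<open>The Lie algebra of \<open>spin_group\<close> inside the Clifford algebra: the bivectors with the
  commutator. The lemmas \<open>vec_rep_commutator\<close> and \<open>bij_betw_vec_rep\<close> below identify it with
  the skew-symmetric matrices.\<close>

definition so_alg :: "'n::{finite,linorder} cl set" where
  "so_alg = span {cl_vec (axis i 1) \<odot> cl_vec (axis j 1) | i j. i \<noteq> j}"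

definition commutator :: "'n::{finite,linorder} cl \<Rightarrow> 'n cl \<Rightarrow> 'n cl" where
  "commutator x y = x \<odot> y - y \<odot> x"

definition Ad :: "'n::{finite,linorder} cl \<Rightarrow> 'n cl \<Rightarrow> 'n cl" where
  "Ad p x = p \<odot> x \<odot> cl_inverse p"

definition invariant_form :: "('n::{finite,linorder} cl \<Rightarrow> 'n cl \<Rightarrow> real) \<Rightarrow> bool" where
  "invariant_form B \<longleftrightarrow>
     (\<forall>x\<in>so_alg. \<forall>y\<in>so_alg. \<forall>z\<in>so_alg. B (x + y) z = B x z + B y z) \<and>
     (\<forall>c. \<forall>x\<in>so_alg. \<forall>y\<in>so_alg. B (c *\<^sub>R x) y = c * B x y) \<and>
     (\<forall>x\<in>so_alg. \<forall>y\<in>so_alg. B x y = B y x) \<and>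
     (\<forall>x\<in>so_alg. (\<forall>y\<in>so_alg. B x y = 0) \<longrightarrow> x = 0) \<and>
     (\<forall>x\<in>so_alg. \<forall>y\<in>so_alg. \<forall>z\<in>so_alg. B (commutator x y) z = B x (commutator y z))"


subsection \<open>The Clifford relation, and bivectors as skew-symmetric matrices\<close>

lemma cl_mult_bilinear: "bounded_bilinear (cl_mult :: 'n::{finite,linorder} cl \<Rightarrow> _)"
proof -
  have "bilinear (cl_mult :: 'n cl \<Rightarrow> _)"
    unfolding bilinear_def cl_mult_def
    by (auto intro!: linearI simp: algebra_simps sum.distrib scaleR_sum_right scaleR_add_left)
  then show ?thesis by (simp add: bilinear_conv_bounded_bilinear)
qed

lemma axis_mult: "axis S 1 \<odot> axis T 1 = cl_sign S T *\<^sub>R axis (sym_diff S T) (1::real)"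
proof -
  have "axis S 1 \<odot> axis T 1 = (\<Sum>S'\<in>UNIV. \<Sum>T'\<in>UNIV. if T' = T then (if S' = S then cl_sign S T *\<^sub>R axis (sym_diff S T) (1::real) else 0) else 0)"
    unfolding cl_mult_def by (intro sum.cong) (auto simp: axis_def)
  then show ?thesis by (simp add: sum.delta')
qed

lemma cl_sign_one: "cl_sign {} T = 1" "cl_sign S {} = 1"
  by (auto simp: cl_sign_def)

lemma minus_one_power_card_sym_diff:
  assumes "finite A" "finite B" shows "(-1::real) ^ card (sym_diff A B) = (-1) ^ card A * (-1) ^ card B"
proof -
  have "card A = card (A - B) + card (A \<inter> B)" "card B = card (B - A) + card (A \<inter> B)"
    using assms by (auto simp: card_Diff_subset_Int Int_commute card_mono)
  moreover have "card (sym_diff A B) = card (A - B) + card (B - A)"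
    using assms by (intro card_Un_disjoint) auto
  ultimately show ?thesis by (simp add: power_add mult.commute mult.left_commute flip: power_mult_distrib)
qed

lemma cl_sign_sym_diff:
  "cl_sign (sym_diff S S') T = cl_sign S T * cl_sign S' T"
  "cl_sign S (sym_diff T T') = cl_sign S T * cl_sign S T'"
proof -
  have 1: "{(s, t). s \<in> sym_diff S S' \<and> t \<in> T \<and> t \<le> s} = sym_diff {(s, t). s \<in> S \<and> t \<in> T \<and> t \<le> s} {(s, t). s \<in> S' \<and> t \<in> T \<and> t \<le> s}"
    by auto
  have 2: "{(s, t). s \<in> S \<and> t \<in> sym_diff T T' \<and> t \<le> s} = sym_diff {(s, t). s \<in> S \<and> t \<in> T \<and> t \<le> s} {(s, t). s \<in> S \<and> t \<in> T' \<and> t \<le> s}"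
    by auto
  show "cl_sign (sym_diff S S') T = cl_sign S T * cl_sign S' T"
    unfolding cl_sign_def 1 by (intro minus_one_power_card_sym_diff finite)
  show "cl_sign S (sym_diff T T') = cl_sign S T * cl_sign S T'"
    unfolding cl_sign_def 2 by (intro minus_one_power_card_sym_diff finite)
qed

lemma cl_expand: "(x::'n::{finite,linorder} cl) = (\<Sum>S\<in>UNIV. x $ S *\<^sub>R axis S 1)"
  by (simp add: vec_eq_iff axis_def if_distrib cong: if_cong)

interpretation cl: bounded_bilinear "cl_mult :: 'n::{finite,linorder} cl \<Rightarrow> _"
  by (rule cl_mult_bilinear)

lemma cl_mult_assoc: "x \<odot> y \<odot> z = x \<odot> (y \<odot> z)"
proof -
  have ax: "axis S 1 \<odot> axis T 1 \<odot> axis R 1 = axis S 1 \<odot> (axis T 1 \<odot> axis R 1)" for S T R :: "'a set"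
  proof -
    have "sym_diff (sym_diff S T) R = sym_diff S (sym_diff T R)" by auto
    then show ?thesis
      by (simp add: axis_mult cl.scaleR_left cl.scaleR_right cl_sign_sym_diff del: Un_Diff)
  qed
  show ?thesis
    by (subst (1 2) cl_expand[of x], subst (1 2) cl_expand[of y], subst (1 2) cl_expand[of z])
      (simp only: cl.sum_left cl.sum_right cl.scaleR_left cl.scaleR_right ax scaleR_sum_right)
qed

lemma cl_mult_one [simp]: "cl_one \<odot> x = x" "x \<odot> cl_one = x"
  by (subst (1 2) cl_expand[of x], simp add: cl_one_def cl.sum_left cl.sum_right cl.scaleR_left cl.scaleR_right axis_mult cl_sign_one)+


lemma cl_vec_square: "cl_vec v \<odot> cl_vec v = - (v \<bullet> v) *\<^sub>R cl_one"
proof -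
  have anti: "axis {i} 1 \<odot> axis {j} (1::real) = (if i = j then - cl_one else - (axis {j} 1 \<odot> axis {i} 1))" for i j :: 'a
  proof (cases "i = j")
    case True
    have "{(s, t). s \<in> {j} \<and> t \<in> {j} \<and> t \<le> s} = {(j, j)}" by auto
    with True show ?thesis by (simp add: axis_mult cl_sign_def cl_one_def)
  next
    case False
    have "{(s, t). s \<in> {a} \<and> t \<in> {b} \<and> t \<le> s} = (if b \<le> a then {(a, b)} else {})" for a b :: 'a
      by auto
    moreover have "sym_diff {i} {j} = sym_diff {j} {i}" by auto
    ultimately show ?thesis using False by (auto simp: axis_mult cl_sign_def)
  qed
  define P where "P = (\<lambda>i j. (v $ i * v $ j) *\<^sub>R (axis {i} 1 \<odot> axis {j} (1::real)))"
  have P: "P i j + P j i = (if i = j then - (2 * v $ i * v $ i) *\<^sub>R cl_one else 0)" for i j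
    using anti[of i j] unfolding P_def by (auto simp: vec_eq_iff mult.commute)
  have "2 *\<^sub>R (cl_vec v \<odot> cl_vec v) = (\<Sum>i\<in>UNIV. \<Sum>j\<in>UNIV. P i j) + (\<Sum>i\<in>UNIV. \<Sum>j\<in>UNIV. P i j)"
    unfolding scaleR_2 by (subst (1 2) sum.swap) (simp add: cl_vec_def P_def cl.sum_left cl.sum_right
        cl.scaleR_left cl.scaleR_right scaleR_sum_right mult.commute)
  also have "\<dots> = (\<Sum>i\<in>UNIV. \<Sum>j\<in>UNIV. P i j + P j i)"
    by (subst (2) sum.swap) (simp add: sum.distrib)
  also have "\<dots> = 2 *\<^sub>R (- (v \<bullet> v) *\<^sub>R cl_one)"
    by (simp add: P inner_vec_def scaleR_sum_left scaleR_sum_right sum_negf mult.assoc)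
  finally show ?thesis by (simp only: real_vector.scale_cancel_left) simp
qed

text \<open>The derivative of the vector representation: the matrix of \<open>v \<mapsto> [x, v]\<close> on generators.\<close>

definition vec_rep :: "'n cl \<Rightarrow> real ^ 'n::{finite,linorder} ^ 'n::{finite,linorder}" where
  "vec_rep x = (\<chi> i j. commutator x (cl_vec (axis j 1)) $ {i})"

lemma cl_vec_axis: "cl_vec (axis j 1) = axis {j} 1"
proof -
  have "(axis j 1 $ i) *\<^sub>R axis {i} 1 = (if i = j then axis {j} (1::real) else 0)" for i
    by (simp add: axis_def)
  then show ?thesis by (simp add: cl_vec_def)
qed

lemma mem_so_alg_iff: "x \<in> so_alg \<longleftrightarrow> (\<forall>S. card S \<noteq> 2 \<longrightarrow> x $ S = 0)"
proof
  assume "x \<in> so_alg"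
  moreover have "so_alg \<subseteq> {x. \<forall>S. card S \<noteq> 2 \<longrightarrow> x $ S = 0}" (is "_ \<subseteq> ?R")
    unfolding so_alg_def
  proof (rule span_minimal)
    show "subspace ?R" by (auto simp: subspace_def)
    have "sym_diff {i} {j} = {i, j}" if "i \<noteq> j" for i j :: 'a using that by auto
    then show "{cl_vec (axis i 1) \<odot> cl_vec (axis j 1) | i j. i \<noteq> j} \<subseteq> ?R"
      unfolding cl_vec_axis axis_mult by (force simp: axis_def card_2_iff)
  qed
  ultimately show "\<forall>S. card S \<noteq> 2 \<longrightarrow> x $ S = 0" by auto
next
  assume *: "\<forall>S. card S \<noteq> 2 \<longrightarrow> x $ S = 0"
  have "x $ S *\<^sub>R axis S 1 \<in> so_alg" for S
  proof (cases "card S = 2")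
    case True
    then obtain i j where S: "S = {i, j}" "i \<noteq> j" by (auto simp: card_2_iff)
    have "sym_diff {i} {j} = {i, j}" using S by auto
    then have "axis S 1 = cl_sign {i} {j} *\<^sub>R (cl_vec (axis i 1) \<odot> cl_vec (axis j 1))"
      by (simp add: cl_vec_axis axis_mult S(1) cl_sign_def flip: power_add)
    also have "\<dots> \<in> so_alg"
      unfolding so_alg_def using S by (intro span_mul span_base) auto
    finally show ?thesis unfolding so_alg_def by (rule span_mul)
  next
    case False
    then show ?thesis using * by (simp add: so_alg_def span_zero)
  qed
  then have "(\<Sum>S\<in>UNIV. x $ S *\<^sub>R axis S 1) \<in> so_alg"
    unfolding so_alg_def by (intro span_sum)
  then show "x \<in> so_alg" by (simp flip: cl_expand)
qed

lemma sym_diff_singleton_eq_iff: "R = sym_diff S {j} \<longleftrightarrow> S = sym_diff R {j}"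
  by auto

lemma commutator_axis_nth:
  "commutator x (axis {j} 1) $ R =
     x $ sym_diff R {j} * (cl_sign (sym_diff R {j}) {j} - cl_sign {j} (sym_diff R {j}))"
proof -
  have "x \<odot> axis {j} 1 = (\<Sum>S\<in>UNIV. (x $ S * cl_sign S {j}) *\<^sub>R axis (sym_diff S {j}) 1)"
    by (subst cl_expand[of x]) (simp add: cl.sum_left cl.scaleR_left axis_mult)
  moreover have "axis {j} 1 \<odot> x = (\<Sum>S\<in>UNIV. (x $ S * cl_sign {j} S) *\<^sub>R axis (sym_diff S {j}) 1)"
    by (subst cl_expand[of x]) (simp add: cl.sum_right cl.scaleR_right axis_mult Un_commute)
  ultimately show ?thesis
    by (simp add: commutator_def axis_def sym_diff_singleton_eq_iff[of R] sum.delta' algebra_simps if_distrib cong: if_cong del: Un_iff)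
qed


lemma vec_rep_nth:
  assumes "x \<in> so_alg"
  shows "vec_rep x $ i $ j = (if i = j then 0 else if i < j then - 2 * x $ {i, j} else 2 * x $ {i, j})"
proof (cases "i = j")
  case True
  with assms show ?thesis by (simp add: vec_rep_def cl_vec_axis commutator_axis_nth mem_so_alg_iff)
next
  case False
  then have 1: "sym_diff {i} {j} = {i, j}" by auto
  have 2: "{(s, t). s \<in> {i, j} \<and> t \<in> {j} \<and> t \<le> s} = (if j \<le> i then {(i, j), (j, j)} else {(j, j)})"
    "{(s, t). s \<in> {j} \<and> t \<in> {i, j} \<and> t \<le> s} = (if i \<le> j then {(j, i), (j, j)} else {(j, j)})"
    by auto
  show ?thesis
    using False unfolding vec_rep_def cl_vec_axis vec_lambda_beta commutator_axis_nth 1 cl_sign_def 2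
    by auto
qed

lemma commutator_so_alg_axis:
  assumes "x \<in> so_alg"
  shows "commutator x (axis {j} 1) = (\<Sum>i\<in>UNIV. vec_rep x $ i $ j *\<^sub>R axis {i} 1)"
proof -
  have 0: "commutator x (axis {j} 1) $ R = 0" if R: "\<nexists>i. R = {i}" for R
  proof (cases "card (sym_diff R {j}) = 2 \<and> j \<notin> sym_diff R {j}")
    case True
    define S where "S = sym_diff R {j}"
    have "{(s, t). s \<in> S \<and> t \<in> {j} \<and> t \<le> s} = (\<lambda>s. (s, j)) ` {s\<in>S. j \<le> s}"
      "{(s, t). s \<in> {j} \<and> t \<in> S \<and> t \<le> s} = (\<lambda>s. (j, s)) ` {s\<in>S. s \<le> j}" by auto
    then have s: "cl_sign S {j} = (-1) ^ card {s\<in>S. j \<le> s}" "cl_sign {j} S = (-1) ^ card {s\<in>S. s \<le> j}"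
      by (simp_all add: cl_sign_def card_image inj_on_def)
    have "{s\<in>S. j \<le> s} \<inter> {s\<in>S. s \<le> j} = {}" using True unfolding S_def by auto
    then have "card {s\<in>S. j \<le> s} + card {s\<in>S. s \<le> j} = card ({s\<in>S. j \<le> s} \<union> {s\<in>S. s \<le> j})"
      by (intro card_Un_disjoint[symmetric]) auto
    also have "{s\<in>S. j \<le> s} \<union> {s\<in>S. s \<le> j} = S" by auto
    also have "card S = 2" using True unfolding S_def by blast
    finally have "card {s\<in>S. j \<le> s} + card {s\<in>S. s \<le> j} = 2" .
    then have "even (card {s\<in>S. j \<le> s}) = even (card {s\<in>S. s \<le> j})" by presburger
    then have "cl_sign S {j} = cl_sign {j} S"
      unfolding s by (simp add: minus_one_power_iff)
    then show ?thesis by (simp add: commutator_axis_nth flip: S_def)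
  next
    case False
    have "card (sym_diff R {j}) \<noteq> 2"
    proof
      assume c: "card (sym_diff R {j}) = 2"
      with False have "j \<in> sym_diff R {j}" by auto
      then have "R = sym_diff R {j} - {j}" by auto
      moreover have "card (sym_diff R {j} - {j}) = 1" using c \<open>j \<in> sym_diff R {j}\<close> by simp
      ultimately show False using R by (metis card_1_singletonE)
    qed
    then show ?thesis using assms by (simp add: commutator_axis_nth mem_so_alg_iff)
  qed
  show ?thesis
  proof (subst vec_eq_iff, rule allI)
    fix R
    show "commutator x (axis {j} 1) $ R = (\<Sum>i\<in>UNIV. vec_rep x $ i $ j *\<^sub>R axis {i} 1) $ R"
    proof (cases "\<exists>i. R = {i}")
      case True
      then obtain i where R: "R = {i}" by auto
      have "(\<Sum>k\<in>UNIV. vec_rep x $ k $ j *\<^sub>R axis {k} 1) $ R = (\<Sum>k\<in>UNIV. if k = i then vec_rep x $ k $ j else 0)"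
        unfolding R sum_component by (intro sum.cong) (auto simp: axis_def)
      then show ?thesis by (simp add: R vec_rep_def cl_vec_axis)
    next
      case False
      then have "(\<Sum>i\<in>UNIV. vec_rep x $ i $ j *\<^sub>R axis {i} (1::real)) $ R = 0"
        by (auto simp: axis_def intro!: sum.neutral)
      then show ?thesis using 0[OF False] by (simp only:)
    qed
  qed
qed

lemma vec_rep_commutator:
  assumes x: "x \<in> so_alg" and y: "y \<in> so_alg"
  shows "vec_rep (commutator x y) = vec_rep x ** vec_rep y - vec_rep y ** vec_rep x"
proof -
  have lin: "commutator z (\<Sum>k\<in>UNIV. f k *\<^sub>R axis {k} 1) = (\<Sum>k\<in>UNIV. f k *\<^sub>R commutator z (axis {k} 1))" for z :: "'a cl" and f
    by (simp add: commutator_def cl.sum_left cl.sum_right cl.scaleR_left cl.scaleR_right scaleR_diff_right sum_subtractf)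
  have jac: "commutator (commutator x y) z = commutator x (commutator y z) - commutator y (commutator x z)" for z :: "'a cl"
    by (simp add: commutator_def cl.diff_left cl.diff_right cl_mult_assoc)
  have nth: "vec_rep z $ i $ j = commutator z (axis {j} 1) $ {i}" for z :: "'a cl" and i j
    by (simp add: vec_rep_def cl_vec_axis)
  have "vec_rep (commutator x y) $ i $ j = (vec_rep x ** vec_rep y - vec_rep y ** vec_rep x) $ i $ j" for i j
  proof -
    have "commutator (commutator x y) (axis {j} 1) =
        (\<Sum>k\<in>UNIV. vec_rep y $ k $ j *\<^sub>R commutator x (axis {k} 1))
      - (\<Sum>k\<in>UNIV. vec_rep x $ k $ j *\<^sub>R commutator y (axis {k} 1))"
      unfolding jac commutator_so_alg_axis[OF x, of j] commutator_so_alg_axis[OF y, of j] lin ..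
    then have "vec_rep (commutator x y) $ i $ j =
        (\<Sum>k\<in>UNIV. vec_rep y $ k $ j * vec_rep x $ i $ k) - (\<Sum>k\<in>UNIV. vec_rep x $ k $ j * vec_rep y $ i $ k)"
      unfolding nth by simp
    then show ?thesis
      by (simp add: matrix_matrix_mult_def mult.commute)
  qed
  then show ?thesis unfolding vec_eq_iff by blast
qed

lemma bij_betw_vec_rep: "bij_betw vec_rep so_alg {M. transpose M = - M}"
proof (rule bij_betwI')
  fix x y :: "'a cl" assume x: "x \<in> so_alg" and y: "y \<in> so_alg"
  show "vec_rep x = vec_rep y \<longleftrightarrow> x = y"
  proof
    assume eq: "vec_rep x = vec_rep y"
    show "x = y"
    proof (subst vec_eq_iff, rule allI)
      fix S
      show "x $ S = y $ S"
      proof (cases "card S = 2")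
        case True
        then obtain i j where S: "S = {i, j}" "i \<noteq> j" by (auto simp: card_2_iff)
        have "vec_rep x $ i $ j = vec_rep y $ i $ j" by (simp add: eq)
        then show ?thesis using S by (auto simp: vec_rep_nth x y split: if_splits)
      next
        case False
        then show ?thesis using x y by (simp add: mem_so_alg_iff)
      qed
    qed
  qed simp
next
  fix x :: "'a cl" assume "x \<in> so_alg"
  then show "vec_rep x \<in> {M. transpose M = - M}"
    by (auto simp: vec_eq_iff transpose_def vec_rep_nth insert_commute)
next
  fix M :: "real ^ 'a::{finite,linorder} ^ 'a::{finite,linorder}" assume "M \<in> {M. transpose M = - M}"
  then have "transpose M $ i $ j = (- M) $ i $ j" for i j by simp
  then have M: "M $ j $ i = - M $ i $ j" for i j
    unfolding transpose_def vec_lambda_beta vector_uminus_component by fast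
  have M0: "M $ i $ i = 0" for i using M[of i i] by linarith
  define x :: "'a cl" where "x = (\<chi> S. if card S = 2 then - M $ Min S $ Max S / 2 else 0)"
  have x: "x \<in> so_alg" by (simp add: mem_so_alg_iff x_def)
  have "M = vec_rep x"
  proof -
    have "M $ i $ j = vec_rep x $ i $ j" for i j
    proof -
      consider "i < j" | "j < i" | "i = j" by force
      then show ?thesis
      proof cases
        case 2
        then have "vec_rep x $ i $ j = - M $ j $ i" unfolding vec_rep_nth[OF x] by (auto simp: x_def)
        then show ?thesis using M[of j i] by linarith
      qed (unfold vec_rep_nth[OF x], simp_all add: x_def M0)
    qed
    then show ?thesis by (simp add: vec_eq_iff)
  qed
  then show "\<exists>x\<in>so_alg. M = vec_rep x" using x by blast
qed


section \<open>Smooth manifolds\<close>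

text \<open>\<open>C_k m k V f\<close>: on the open subset \<open>V\<close> of \<open>m\<close>-dimensional Euclidean space all iterated
  partial derivatives of \<open>f\<close> up to order \<open>k\<close> exist and are continuous.\<close>

primrec C_k :: "nat \<Rightarrow> nat \<Rightarrow> (nat \<Rightarrow> real) set \<Rightarrow> ((nat \<Rightarrow> real) \<Rightarrow> real) \<Rightarrow> bool" where
  "C_k m 0 V f \<longleftrightarrow> continuous_map (subtopology (Euclidean_space m) V) euclideanreal f"
| "C_k m (Suc k) V f \<longleftrightarrow>
     continuous_map (subtopology (Euclidean_space m) V) euclideanreal f \<and>
     (\<forall>i<m. \<exists>f'. (\<forall>x\<in>V. ((\<lambda>t. f (x(i := x i + t))) has_real_derivative f' x) (at 0)) \<and>
                 C_k m k V f')"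

definition smooth_on :: "nat \<Rightarrow> (nat \<Rightarrow> real) set \<Rightarrow> ((nat \<Rightarrow> real) \<Rightarrow> real) \<Rightarrow> bool" where
  "smooth_on m V f \<longleftrightarrow> (\<forall>k. C_k m k V f)"

text \<open>A chart is a pair of its domain and its coordinate map. The manifold is the whole type
  \<open>'u\<close>; its dimension \<open>m\<close> may be 0.\<close>

definition smooth_atlas ::
    "nat \<Rightarrow> ('u::{t2_space,second_countable_topology} set \<times> ('u \<Rightarrow> nat \<Rightarrow> real)) set \<Rightarrow> bool" where
  "smooth_atlas m \<A> \<longleftrightarrow>
     \<Union>(fst ` \<A>) = UNIV \<and>
     (\<forall>(D, \<phi>)\<in>\<A>. open D \<and> openin (Euclidean_space m) (\<phi> ` D) \<and>
        homeomorphic_map (top_of_set D) (subtopology (Euclidean_space m) (\<phi> ` D)) \<phi>) \<and>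
     (\<forall>(D, \<phi>)\<in>\<A>. \<forall>(D', \<phi>')\<in>\<A>. \<forall>i<m.
        smooth_on m (\<phi> ` (D \<inter> D')) (\<lambda>y. \<phi>' (inv_into D \<phi> y) i))"

definition smooth_functions ::
    "nat \<Rightarrow> ('u::{t2_space,second_countable_topology} set \<times> ('u \<Rightarrow> nat \<Rightarrow> real)) set \<Rightarrow>
      ('u \<Rightarrow> real) set" where
  "smooth_functions m \<A> = {f. \<forall>(D, \<phi>)\<in>\<A>. smooth_on m (\<phi> ` D) (f \<circ> inv_into D \<phi>)}"


section \<open>Vector fields and differential forms\<close>

text \<open>From here on \<open>C\<close> stands for the algebra of smooth functions of a manifold. Following
  Helgason, vector fields are the derivations of \<open>C\<close>, and differential forms are the alternating
  \<open>C\<close>-multilinear maps on the \<open>C\<close>-module of vector fields. All of these are extended by \<open>0\<close> outside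
  their domain, so that equality of the underlying functions is the intended equality.\<close>

type_synonym 'u vfield = "('u \<Rightarrow> real) \<Rightarrow> 'u \<Rightarrow> real"
type_synonym ('u, 'v) form1 = "'u vfield \<Rightarrow> 'u \<Rightarrow> 'v"
type_synonym ('u, 'v) form2 = "'u vfield \<Rightarrow> 'u vfield \<Rightarrow> 'u \<Rightarrow> 'v"
type_synonym ('u, 'v) form3 = "'u vfield \<Rightarrow> 'u vfield \<Rightarrow> 'u vfield \<Rightarrow> 'u \<Rightarrow> 'v"

definition vector_fields :: "('u \<Rightarrow> real) set \<Rightarrow> 'u vfield set" where
  "vector_fields C = {X.
     (\<forall>f\<in>C. X f \<in> C) \<and> (\<forall>f. f \<notin> C \<longrightarrow> X f = 0) \<and>
     (\<forall>f\<in>C. \<forall>g\<in>C. X (f + g) = X f + X g) \<and>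
     (\<forall>c. \<forall>f\<in>C. X (\<lambda>x. c * f x) = (\<lambda>x. c * X f x)) \<and>
     (\<forall>f\<in>C. \<forall>g\<in>C. X (f * g) = f * X g + g * X f)}"

definition vf_bracket :: "'u vfield \<Rightarrow> 'u vfield \<Rightarrow> 'u vfield" where
  "vf_bracket X Y = (\<lambda>f. X (Y f) - Y (X f))"

text \<open>Smooth maps into a subset \<open>W\<close> of a Euclidean space. For the closed subgroup \<open>spin_group\<close> of
  the units of the Clifford algebra, an embedded submanifold, these are the smooth maps into it.\<close>

definition smooth_maps :: "('u \<Rightarrow> real) set \<Rightarrow> 'v::euclidean_space set \<Rightarrow> ('u \<Rightarrow> 'v) set" where
  "smooth_maps C W = {f. (\<forall>x. f x \<in> W) \<and> (\<forall>b\<in>Basis. (\<lambda>x. f x \<bullet> b) \<in> C)}"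

text \<open>The derivative \<open>X f\<close> of a vector-valued function, i.e. its differential applied to \<open>X\<close>.
  For real-valued \<open>f\<close> it is just \<open>X f\<close>.\<close>

definition deriv_along :: "'u vfield \<Rightarrow> ('u \<Rightarrow> 'v::euclidean_space) \<Rightarrow> 'u \<Rightarrow> 'v" where
  "deriv_along X f = (\<lambda>x. \<Sum>b\<in>Basis. X (\<lambda>y. f y \<bullet> b) x *\<^sub>R b)"

lemma deriv_along_real: "deriv_along X (f :: 'u \<Rightarrow> real) = X f"
  by (simp add: deriv_along_def)

definition forms1 :: "('u \<Rightarrow> real) set \<Rightarrow> 'v::euclidean_space set \<Rightarrow> ('u, 'v) form1 set" where
  "forms1 C W = {\<theta>.
     (\<forall>X\<in>vector_fields C. \<theta> X \<in> smooth_maps C W) \<and>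
     (\<forall>X. X \<notin> vector_fields C \<longrightarrow> \<theta> X = 0) \<and>
     (\<forall>X\<in>vector_fields C. \<forall>Y\<in>vector_fields C. \<theta> (X + Y) = \<theta> X + \<theta> Y) \<and>
     (\<forall>h\<in>C. \<forall>X\<in>vector_fields C. \<theta> (\<lambda>f. h * X f) = (\<lambda>x. h x *\<^sub>R \<theta> X x))}"

definition forms2 :: "('u \<Rightarrow> real) set \<Rightarrow> 'v::euclidean_space set \<Rightarrow> ('u, 'v) form2 set" where
  "forms2 C W = {\<omega>.
     (\<forall>X\<in>vector_fields C. \<omega> X \<in> forms1 C W) \<and>
     (\<forall>X. X \<notin> vector_fields C \<longrightarrow> \<omega> X = 0) \<and>
     (\<forall>X Y. \<omega> X Y = - \<omega> Y X)}"

definition d1 :: "('u \<Rightarrow> real) set \<Rightarrow> ('u, 'v::euclidean_space) form1 \<Rightarrow> ('u, 'v) form2" where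
  "d1 C \<theta> X Y =
     (if X \<in> vector_fields C \<and> Y \<in> vector_fields C
      then deriv_along X (\<theta> Y) - deriv_along Y (\<theta> X) - \<theta> (vf_bracket X Y) else 0)"

definition d2 :: "('u \<Rightarrow> real) set \<Rightarrow> ('u, 'v::euclidean_space) form2 \<Rightarrow> ('u, 'v) form3" where
  "d2 C \<omega> X Y Z =
     (if X \<in> vector_fields C \<and> Y \<in> vector_fields C \<and> Z \<in> vector_fields C
      then deriv_along X (\<omega> Y Z) - deriv_along Y (\<omega> X Z) + deriv_along Z (\<omega> X Y)
         - \<omega> (vf_bracket X Y) Z + \<omega> (vf_bracket X Z) Y - \<omega> (vf_bracket Y Z) X else 0)"

definition lie_derivative :: "('u \<Rightarrow> real) set \<Rightarrow> 'u vfield \<Rightarrow> ('u, real) form1 \<Rightarrow> ('u, real) form1" where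
  "lie_derivative C X \<eta> Z =
     (if Z \<in> vector_fields C then X (\<eta> Z) - \<eta> (vf_bracket X Z) else 0)"

text \<open>Wedge products of alternating maps with respect to a bilinear map \<open>\<beta>\<close>, normalised without
  factorials; \<open>'x\<close> is a space of tangent vectors at a point or of vector fields.\<close>

definition alt11 :: "('v \<Rightarrow> 'w \<Rightarrow> 'z::ab_group_add) \<Rightarrow> ('x \<Rightarrow> 'v) \<Rightarrow> ('x \<Rightarrow> 'w) \<Rightarrow> 'x \<Rightarrow> 'x \<Rightarrow> 'z" where
  "alt11 \<beta> \<theta> \<eta> X Y = \<beta> (\<theta> X) (\<eta> Y) - \<beta> (\<theta> Y) (\<eta> X)"

definition alt12 ::
    "('v \<Rightarrow> 'w \<Rightarrow> 'z::ab_group_add) \<Rightarrow> ('x \<Rightarrow> 'v) \<Rightarrow> ('x \<Rightarrow> 'x \<Rightarrow> 'w) \<Rightarrow> 'x \<Rightarrow> 'x \<Rightarrow> 'x \<Rightarrow> 'z" where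
  "alt12 \<beta> \<theta> \<omega> X Y Z = \<beta> (\<theta> X) (\<omega> Y Z) - \<beta> (\<theta> Y) (\<omega> X Z) + \<beta> (\<theta> Z) (\<omega> X Y)"

definition wedge11 ::
    "('v \<Rightarrow> 'w \<Rightarrow> 'z::ab_group_add) \<Rightarrow> ('u, 'v) form1 \<Rightarrow> ('u, 'w) form1 \<Rightarrow> ('u, 'z) form2" where
  "wedge11 \<beta> \<theta> \<eta> = (\<lambda>X Y x. alt11 \<beta> (\<lambda>Z. \<theta> Z x) (\<lambda>Z. \<eta> Z x) X Y)"

definition wedge12 ::
    "('v \<Rightarrow> 'w \<Rightarrow> 'z::ab_group_add) \<Rightarrow> ('u, 'v) form1 \<Rightarrow> ('u, 'w) form2 \<Rightarrow> ('u, 'z) form3" where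
  "wedge12 \<beta> \<theta> \<omega> = (\<lambda>X Y Z x. alt12 \<beta> (\<lambda>Z. \<theta> Z x) (\<lambda>Y Z. \<omega> Y Z x) X Y Z)"

definition cs3 ::
    "('u \<Rightarrow> real) set \<Rightarrow> ('n::{finite,linorder} cl \<Rightarrow> 'n cl \<Rightarrow> real) \<Rightarrow> ('u, 'n cl) form1 \<Rightarrow>
      ('u, real) form3" where
  "cs3 C B \<theta> = (\<lambda>X Y Z x. wedge12 B \<theta> (d1 C \<theta>) X Y Z x
                        + 1/3 * wedge12 B \<theta> (wedge11 commutator \<theta> \<theta>) X Y Z x)"


section \<open>The Maurer--Cartan form and the Cartan 3-form\<close>

text \<open>Forms on the group take a point and tangent vectors at it, the latter as elements of the
  ambient Clifford algebra.\<close>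

definition maurer_cartan :: "'n::{finite,linorder} cl \<Rightarrow> 'n cl \<Rightarrow> 'n cl" where
  "maurer_cartan p v = v \<odot> cl_inverse p"

definition cartan3 ::
    "('n::{finite,linorder} cl \<Rightarrow> 'n cl \<Rightarrow> real) \<Rightarrow> 'n cl \<Rightarrow> 'n cl \<Rightarrow> 'n cl \<Rightarrow> 'n cl \<Rightarrow> real" where
  "cartan3 B p u v w =
     1/6 * alt12 B (maurer_cartan p) (alt11 commutator (maurer_cartan p) (maurer_cartan p)) u v w"

definition pullback1 ::
    "('u \<Rightarrow> real) set \<Rightarrow> ('u \<Rightarrow> 'n::{finite,linorder} cl) \<Rightarrow> ('n cl \<Rightarrow> 'n cl \<Rightarrow> 'v::zero) \<Rightarrow>
      ('u, 'v) form1" where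
  "pullback1 C g \<alpha> X =
     (if X \<in> vector_fields C then (\<lambda>x. \<alpha> (g x) (deriv_along X g x)) else 0)"

definition pullback3 ::
    "('u \<Rightarrow> real) set \<Rightarrow> ('u \<Rightarrow> 'n::{finite,linorder} cl) \<Rightarrow>
      ('n cl \<Rightarrow> 'n cl \<Rightarrow> 'n cl \<Rightarrow> 'n cl \<Rightarrow> 'v::zero) \<Rightarrow> ('u, 'v) form3" where
  "pullback3 C g \<alpha> X Y Z =
     (if X \<in> vector_fields C \<and> Y \<in> vector_fields C \<and> Z \<in> vector_fields C
      then (\<lambda>x. \<alpha> (g x) (deriv_along X g x) (deriv_along Y g x) (deriv_along Z g x)) else 0)"


section \<open>The standard transitive Courant algebroid\<close>

type_synonym ('u, 'n) ca_section = "'u vfield \<times> ('u \<Rightarrow> 'n cl) \<times> ('u, real) form1"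

definition ca_sections :: "('u \<Rightarrow> real) set \<Rightarrow> ('u, 'n::{finite,linorder}) ca_section set" where
  "ca_sections C = vector_fields C \<times> smooth_maps C so_alg \<times> forms1 C UNIV"

definition ca_scale ::
    "('u \<Rightarrow> real) \<Rightarrow> ('u, 'n::{finite,linorder}) ca_section \<Rightarrow> ('u, 'n) ca_section" where
  "ca_scale h = (\<lambda>(X, a, \<xi>). ((\<lambda>f. h * X f), (\<lambda>x. h x *\<^sub>R a x), (\<lambda>Z. h * \<xi> Z)))"

definition ca_anchor :: "('u, 'n::{finite,linorder}) ca_section \<Rightarrow> 'u vfield" where
  "ca_anchor = (\<lambda>(X, a, \<xi>). X)"

definition ca_pairing ::
    "('n::{finite,linorder} cl \<Rightarrow> 'n cl \<Rightarrow> real) \<Rightarrow> ('u, 'n) ca_section \<Rightarrow> ('u, 'n) ca_section \<Rightarrow>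
      'u \<Rightarrow> real" where
  "ca_pairing B = (\<lambda>(X, a, \<xi>) (Y, b, \<eta>). (\<lambda>x. 1/2 * (\<xi> Y x + \<eta> X x) + B (a x) (b x)))"

definition ca_P ::
    "('u \<Rightarrow> real) set \<Rightarrow> ('n::{finite,linorder} cl \<Rightarrow> 'n cl \<Rightarrow> real) \<Rightarrow>
      ('u \<Rightarrow> 'n cl) \<Rightarrow> ('u \<Rightarrow> 'n cl) \<Rightarrow> ('u, real) form1" where
  "ca_P C B a b Y =
     (if Y \<in> vector_fields C then (\<lambda>x. 2 * B (b x) (deriv_along Y a x)) else 0)"

definition ca_bracket ::
    "('u \<Rightarrow> real) set \<Rightarrow> ('n::{finite,linorder} cl \<Rightarrow> 'n cl \<Rightarrow> real) \<Rightarrow>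
      ('u, 'n) ca_section \<Rightarrow> ('u, 'n) ca_section \<Rightarrow> ('u, 'n) ca_section" where
  "ca_bracket C B = (\<lambda>(X, a, \<xi>) (Y, b, \<eta>).
     (vf_bracket X Y,
      deriv_along X b - deriv_along Y a + (\<lambda>x. commutator (a x) (b x)),
      lie_derivative C X \<eta> - d1 C \<xi> Y + ca_P C B a b))"

text \<open>Automorphisms covering the identity of the base, as invertible \<open>C\<close>-linear maps of sections.\<close>

definition ca_automorphism ::
    "('u \<Rightarrow> real) set \<Rightarrow> ('n::{finite,linorder} cl \<Rightarrow> 'n cl \<Rightarrow> real) \<Rightarrow>
      (('u, 'n) ca_section \<Rightarrow> ('u, 'n) ca_section) \<Rightarrow> bool" where
  "ca_automorphism C B \<Lambda> \<longleftrightarrow>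
     bij_betw \<Lambda> (ca_sections C) (ca_sections C) \<and>
     (\<forall>e\<in>ca_sections C. \<forall>e'\<in>ca_sections C. \<Lambda> (e + e') = \<Lambda> e + \<Lambda> e') \<and>
     (\<forall>h\<in>C. \<forall>e\<in>ca_sections C. \<Lambda> (ca_scale h e) = ca_scale h (\<Lambda> e)) \<and>
     (\<forall>e\<in>ca_sections C. ca_anchor (\<Lambda> e) = ca_anchor e) \<and>
     (\<forall>e\<in>ca_sections C. \<forall>e'\<in>ca_sections C. ca_pairing B (\<Lambda> e) (\<Lambda> e') = ca_pairing B e e') \<and>
     (\<forall>e\<in>ca_sections C. \<forall>e'\<in>ca_sections C.
        \<Lambda> (ca_bracket C B e e') = ca_bracket C B (\<Lambda> e) (\<Lambda> e'))"

text \<open>The block matrix with rows \<open>(1, 0, 0)\<close>, \<open>(\<phi>, \<psi>, 0)\<close>, \<open>(\<beta>, \<gamma>, 1)\<close>.\<close>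

definition block_matrix ::
    "('u vfield \<Rightarrow> 'u \<Rightarrow> 'n::{finite,linorder} cl) \<Rightarrow> (('u \<Rightarrow> 'n cl) \<Rightarrow> 'u \<Rightarrow> 'n cl) \<Rightarrow>
     ('u vfield \<Rightarrow> ('u, real) form1) \<Rightarrow> (('u \<Rightarrow> 'n cl) \<Rightarrow> ('u, real) form1) \<Rightarrow>
     ('u, 'n) ca_section \<Rightarrow> ('u, 'n) ca_section" where
  "block_matrix \<phi> \<psi> \<beta> \<gamma> = (\<lambda>(X, a, \<xi>). (X, \<phi> X + \<psi> a, \<beta> X + \<gamma> a + \<xi>))"

definition Ad_map :: "('u \<Rightarrow> 'n::{finite,linorder} cl) \<Rightarrow> ('u \<Rightarrow> 'n cl) \<Rightarrow> 'u \<Rightarrow> 'n cl" where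
  "Ad_map g a = (\<lambda>x. Ad (g x) (a x))"

definition form_star ::
    "('n::{finite,linorder} cl \<Rightarrow> 'n cl \<Rightarrow> real) \<Rightarrow> ('u, 'n cl) form1 \<Rightarrow> ('u \<Rightarrow> 'n cl) \<Rightarrow>
      ('u, real) form1" where
  "form_star B \<phi> a = (\<lambda>X x. B (a x) (\<phi> X x))"

definition inner_matrix ::
    "('u \<Rightarrow> real) set \<Rightarrow> ('n::{finite,linorder} cl \<Rightarrow> 'n cl \<Rightarrow> real) \<Rightarrow>
     ('u \<Rightarrow> 'n cl) \<Rightarrow> ('u, real) form2 \<Rightarrow> ('u, 'n) ca_section \<Rightarrow> ('u, 'n) ca_section" where
  "inner_matrix C B g \<omega> =
     block_matrix
       (- pullback1 C g maurer_cartan)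
       (Ad_map g)
       (\<omega> - (form_star B (pullback1 C g maurer_cartan) \<circ> pullback1 C g maurer_cartan))
       (2 * (form_star B (pullback1 C g maurer_cartan) \<circ> Ad_map g))"

definition inner_automorphism ::
    "('u \<Rightarrow> real) set \<Rightarrow> ('n::{finite,linorder} cl \<Rightarrow> 'n cl \<Rightarrow> real) \<Rightarrow>
      (('u, 'n) ca_section \<Rightarrow> ('u, 'n) ca_section) \<Rightarrow> bool" where
  "inner_automorphism C B \<Lambda> \<longleftrightarrow>
     ca_automorphism C B \<Lambda> \<and>
     (\<exists>g\<in>smooth_maps C spin_group. \<exists>\<omega>\<in>forms2 C UNIV.
        d2 C \<omega> + pullback3 C g (cartan3 B) = 0 \<and>
        (\<forall>e\<in>ca_sections C. \<Lambda> e = inner_matrix C B g \<omega> e))"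

end

theory Submission
  imports Defs
begin

text \<open>
  The matrix \<open>\<Lambda>\<close> is the inner matrix of the pair \<open>(g, \<omega>)\<close> with \<open>\<omega> = \<omega>2 + dA + (\<mu> \<and> \<theta>0)\<close>. The
  gauge relation and the Maurer--Cartan equation \<open>d\<mu> = [\<mu>, \<mu>] / 2\<close> give the transgression formula
  \<open>cs3 \<theta>1 - cs3 \<theta>0 = - d(\<mu> \<and> \<theta>0) - g\<^sup>*\<CC>\<close> for the Cartan form \<open>\<CC>\<close>, so that \<open>d\<omega> + g\<^sup>*\<CC> = 0\<close>; this
  closedness is exactly what makes an inner matrix compatible with the bracket. No information on
  the tangent spaces of the spin group is needed, because the gauge relation itself forces
  \<open>\<mu> = Ad\<^sub>g \<theta>1 - \<theta>0\<close> to have values in the Lie algebra. The form is only infinitesimally invariant by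
  assumption. For unit vectors \<open>v\<close>, \<open>w\<close> put \<open>E = [v, w] / 2\<close>, \<open>D = [E, \<cdot>]\<close> and \<open>c = \<langle>v, w\<rangle>\<close>; then
  \<open>Ad\<^bsub>vw\<^esub> = 1 - c D + D\<^sup>2 / 2\<close> and \<open>D\<^sup>3 = 4 (c\<^sup>2 - 1) D\<close>, from which invariance under \<open>Ad\<^bsub>vw\<^esub>\<close> follows
  algebraically, without connectedness of the group.
\<close>

section \<open>The adjoint action of the spin group\<close>

lemma cl_sign_square: "cl_sign S T * cl_sign S T = 1"
  by (simp add: cl_sign_def flip: power_add)

text \<open>\<open>cl_sign S S\<close> is the square of the monomial with index \<open>S\<close>, so this inverts every monomial.\<close>

definition cl_conj :: "'n::{finite,linorder} cl \<Rightarrow> 'n cl" where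
  "cl_conj x = (\<chi> S. cl_sign S S * x $ S)"

lemma linear_cl_conj: "linear cl_conj"
  by (rule linearI) (simp_all add: cl_conj_def vec_eq_iff algebra_simps)

lemma cl_conj_axis: "cl_conj (axis S 1) = cl_sign S S *\<^sub>R axis S 1"
  by (simp add: cl_conj_def vec_eq_iff axis_def)

text \<open>\<open>cl_conj\<close> is Clifford conjugation, the anti-automorphism with v -> -v. On
  monomials the sign of the pair (S+T, S+T), with + the symmetric difference, splits into four signs
  because \<open>cl_sign\<close> is multiplicative in each argument. The factor
  \<open>cl_sign S T\<close> then occurs twice and cancels; bilinearity does the rest.\<close>

lemma cl_conj_mult: "cl_conj (x \<odot> y) = cl_conj y \<odot> cl_conj x"
proof -
  interpret conj: linear "cl_conj :: 'a cl \<Rightarrow> _" by (rule linear_cl_conj)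
  have ax: "cl_conj (axis S 1 \<odot> axis T 1) = cl_conj (axis T 1) \<odot> cl_conj (axis S 1)" for S T :: "'a set"
  proof -
    have "cl_sign (sym_diff S T) (sym_diff S T)
        = cl_sign S S * cl_sign S T * (cl_sign T S * cl_sign T T)"
      by (simp only: cl_sign_sym_diff ac_simps)
    then have "cl_sign S T * cl_sign (sym_diff S T) (sym_diff S T)
        = (cl_sign S T * cl_sign S T) * (cl_sign S S * cl_sign T S * cl_sign T T)"
      by (simp only: ac_simps)
    moreover have "sym_diff T S = sym_diff S T" by auto
    ultimately show ?thesis
      by (simp add: axis_mult cl_conj_axis conj.scaleR cl.scaleR_left cl.scaleR_right cl_sign_square
          ac_simps del: Un_Diff)
  qed
  show ?thesis
    by (subst (1 2) cl_expand[of x], subst (1 2) cl_expand[of y])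
      (simp only: cl.sum_left cl.sum_right cl.scaleR_left cl.scaleR_right conj.sum conj.scaleR ax
        scaleR_sum_right, subst sum.swap, simp only: scaleR_left_commute)
qed

lemma linear_cl_vec: "linear cl_vec"
  by (rule linearI) (simp_all add: cl_vec_def algebra_simps sum.distrib scaleR_sum_right)

lemma cl_conj_one: "cl_conj cl_one = cl_one"
  by (simp add: cl_one_def cl_conj_axis cl_sign_one)

lemma cl_conj_vec: "cl_conj (cl_vec v) = - cl_vec v"
proof -
  interpret conj: linear "cl_conj :: 'a cl \<Rightarrow> _" by (rule linear_cl_conj)
  have "{(s, t). s \<in> {i} \<and> t \<in> {i} \<and> t \<le> s} = {(i, i)}" for i :: 'a by auto
  then have "cl_sign {i} {i} = -1" for i :: 'a by (simp add: cl_sign_def)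
  then show ?thesis
    by (simp add: cl_vec_def conj.sum conj.scaleR cl_conj_axis sum_negf)
qed

lemma cl_vec_unit_square: "norm v = 1 \<Longrightarrow> cl_vec v \<odot> cl_vec v = - cl_one"
  by (simp add: cl_vec_square dot_square_norm)

text \<open>Polarisation of \<open>cl_vec_square\<close> at v + w.\<close>

lemma cl_vec_anticommute: "cl_vec v \<odot> cl_vec w = - (cl_vec w \<odot> cl_vec v) - (2 * (v \<bullet> w)) *\<^sub>R cl_one"
proof -
  have "cl_vec (v + w) \<odot> cl_vec (v + w) = - ((v + w) \<bullet> (v + w)) *\<^sub>R cl_one"
    by (rule cl_vec_square)
  then show ?thesis
    by (simp add: linear_add[OF linear_cl_vec] cl.add_left cl.add_right cl_vec_square inner_add_left
        inner_add_right inner_commute algebra_simps)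
      (simp add: eq_diff_eq eq_neg_iff_add_eq_0 ac_simps flip: scaleR_add_left)
qed

text \<open>The products telescope: conjugating v w gives w v, so equal unit vectors meet in the
  middle and each pair contributes -1, twice in all.\<close>

lemma spin_group_conj:
  assumes "g \<in> spin_group"
  shows "g \<odot> cl_conj g = cl_one" "cl_conj g \<odot> g = cl_one"
proof -
  \<comment> \<open>Cancellation of a squared unit vector inside a product nested to the right, the
    shape left by \<open>cl_mult_assoc\<close>.\<close>
  have mid: "x \<odot> (cl_vec v \<odot> (cl_vec v \<odot> y)) = - (x \<odot> y)" if "norm v = 1" for x y v
  proof -
    have "x \<odot> (cl_vec v \<odot> (cl_vec v \<odot> y)) = x \<odot> ((cl_vec v \<odot> cl_vec v) \<odot> y)"
      by (simp add: cl_mult_assoc)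
    then show ?thesis by (simp add: cl_vec_unit_square[OF that] cl.minus_left cl.minus_right)
  qed
  from assms have "g \<odot> cl_conj g = cl_one \<and> cl_conj g \<odot> g = cl_one"
  proof induction
    case (step g v w)
    have "cl_vec w \<odot> (cl_vec v \<odot> (cl_conj g \<odot> (g \<odot> (cl_vec v \<odot> cl_vec w))))
        = cl_vec w \<odot> (cl_vec v \<odot> ((cl_conj g \<odot> g) \<odot> (cl_vec v \<odot> cl_vec w)))"
      by (simp add: cl_mult_assoc)
    also have "\<dots> = cl_one"
      using step mid[of v "cl_vec w" "cl_vec w"] by (simp add: cl_vec_unit_square)
    finally show ?case
      using step mid[of w "g \<odot> cl_vec v" "cl_vec v \<odot> cl_conj g"] mid[of v g "cl_conj g"]
      by (simp add: cl_conj_mult cl_conj_vec cl.minus_left cl.minus_right cl_mult_assoc)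
  qed (simp add: cl_conj_one)
  then show "g \<odot> cl_conj g = cl_one" "cl_conj g \<odot> g = cl_one" by auto
qed

text \<open>This replaces the definite description by an explicit formula. The coordinates of the
  inverse are those of \<open>g\<close> up to sign, which makes inversion smooth.\<close>

lemma cl_inverse_spin_group:
  assumes "g \<in> spin_group"
  shows "cl_inverse g = cl_conj g"
  unfolding cl_inverse_def
proof (rule the_equality)
  fix y assume y: "g \<odot> y = cl_one \<and> y \<odot> g = cl_one"
  have "y = (y \<odot> g) \<odot> cl_conj g"
    by (simp add: cl_mult_assoc spin_group_conj assms)
  then show "y = cl_conj g" using y by simp
qed (simp add: spin_group_conj assms)

section \<open>The bivectors as a Lie algebra, and their stability under reflections\<close>

lemma bilinear_commutator: "bounded_bilinear (commutator :: 'n::{finite,linorder} cl \<Rightarrow> _)"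
proof -
  have "bilinear (commutator :: 'n cl \<Rightarrow> _)"
    unfolding bilinear_def commutator_def
    by (auto intro!: linearI simp: cl.add_left cl.add_right cl.scaleR_left cl.scaleR_right algebra_simps)
  then show ?thesis by (simp add: bilinear_conv_bounded_bilinear)
qed

interpretation comm: bounded_bilinear "commutator :: 'n::{finite,linorder} cl \<Rightarrow> _"
  by (rule bilinear_commutator)

lemma commutator_flip: "commutator y x = - commutator x y"
  by (simp add: commutator_def)

lemma commutator_self [simp]: "commutator x x = 0"
  by (simp add: commutator_def)

lemma commutator_jacobi:
  "commutator x (commutator y z) = commutator (commutator x y) z + commutator y (commutator x z)"
  by (simp add: commutator_def cl.diff_left cl.diff_right cl_mult_assoc)

lemma subspace_so_alg: "subspace so_alg"
  by (simp add: so_alg_def)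

lemmas so_alg_closed [simp] =
  subspace_0[OF subspace_so_alg] subspace_add[OF subspace_so_alg] subspace_diff[OF subspace_so_alg]
  subspace_neg[OF subspace_so_alg] subspace_scale[OF subspace_so_alg]

lemma commutator_cl_vec_mem: "commutator (cl_vec v) (cl_vec w) \<in> so_alg"
proof -
  have "commutator (axis {i} 1) (axis {j} 1) \<in> so_alg" for i j :: 'a
  proof (cases "i = j")
    case False
    then show ?thesis
      unfolding so_alg_def commutator_def
      by (intro span_diff span_base) (force simp: cl_vec_axis)+
  qed simp
  then show ?thesis
    by (simp add: cl_vec_def comm.sum_left comm.sum_right comm.scaleR_left comm.scaleR_right
        subspace_sum[OF subspace_so_alg])
qed

text \<open>Distinct basis vectors anticommute, so each generator of \<open>so_alg\<close> is half a
  commutator. Commutators of arbitrary vectors are the better test elements, because linear actions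
  on vectors destroy orthogonality of the two factors but not the form of a commutator.\<close>

lemma linear_maps_so_alg:
  fixes f :: "'n::{finite,linorder} cl \<Rightarrow> 'm::{finite,linorder} cl"
  assumes f: "linear f" and mem: "\<And>v w. f (commutator (cl_vec v) (cl_vec w)) \<in> so_alg"
    and x: "x \<in> so_alg"
  shows "f x \<in> so_alg"
proof -
  have "so_alg \<subseteq> {x. f x \<in> so_alg}"
  proof -
    have "{cl_vec (axis i 1) \<odot> cl_vec (axis j 1) | i j. i \<noteq> j} \<subseteq> {x. f x \<in> so_alg}"
    proof clarify
      fix i j :: 'n assume "i \<noteq> j"
      then have "axis i 1 \<bullet> axis j (1::real) = 0" by (simp add: inner_axis_axis)
      then have "cl_vec (axis i 1) \<odot> cl_vec (axis j 1)
          = (1/2) *\<^sub>R commutator (cl_vec (axis i 1)) (cl_vec (axis j 1))"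
        using cl_vec_anticommute[of "axis i 1" "axis j 1"]
        by (simp add: commutator_def flip: scaleR_2)
      then show "f (cl_vec (axis i 1) \<odot> cl_vec (axis j 1)) \<in> so_alg"
        by (simp add: linear_cmul[OF f] mem del: cl_vec_axis)
    qed
    moreover have "subspace {x. f x \<in> so_alg}"
      by (simp add: subspace_def linear_0[OF f] linear_add[OF f] linear_cmul[OF f])
    ultimately show ?thesis
      unfolding so_alg_def by (intro span_minimal) simp_all
  qed
  then show ?thesis using x by blast
qed

text \<open>Bivectors act on vectors; the columns of \<open>vec_rep x\<close> give the coordinates
  of the image.\<close>

lemma commutator_so_alg_vec:
  assumes "x \<in> so_alg"
  obtains w where "commutator x (cl_vec v) = cl_vec w"
proof -
  have "commutator x (axis {j} 1) = cl_vec (\<Sum>i\<in>UNIV. vec_rep x $ i $ j *\<^sub>R axis i 1)" for j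
    unfolding commutator_so_alg_axis[OF assms]
    by (simp add: linear_sum[OF linear_cl_vec] linear_cmul[OF linear_cl_vec] cl_vec_axis)
  then have "commutator x (cl_vec v)
      = cl_vec (\<Sum>j\<in>UNIV. v $ j *\<^sub>R (\<Sum>i\<in>UNIV. vec_rep x $ i $ j *\<^sub>R axis i 1))"
    by (simp add: cl_vec_def[of v] comm.sum_right comm.scaleR_right
        linear_sum[OF linear_cl_vec] linear_cmul[OF linear_cl_vec])
  then show ?thesis by (rule that)
qed

text \<open>By the Jacobi identity [x, [v, w]] = [[x, v], w] + [v, [x, w]], and [x, v], [x, w] are
  vectors again.\<close>

lemma commutator_so_alg [simp]:
  assumes "x \<in> so_alg" "y \<in> so_alg"
  shows "commutator x y \<in> so_alg"
proof (rule linear_maps_so_alg[OF _ _ assms(2)])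
  show "linear (commutator x)"
    by (rule bounded_linear.linear[OF comm.bounded_linear_right])
  fix v w
  obtain p q where "commutator x (cl_vec v) = cl_vec p" "commutator x (cl_vec w) = cl_vec q"
    using commutator_so_alg_vec[OF assms(1)] by metis
  then show "commutator x (commutator (cl_vec v) (cl_vec w)) \<in> so_alg"
    by (simp add: commutator_jacobi commutator_cl_vec_mem)
qed

text \<open>For a unit vector v the map u -> v u v is the reflection of vectors in the hyperplane
  orthogonal to v. Inserting v v = -1 between two factors gives v (a b) v = - (v a v)(v b v), so
  commutators of vectors go to commutators of vectors.\<close>

lemma reflection_so_alg:
  assumes v: "norm v = 1" and x: "x \<in> so_alg"
  shows "cl_vec v \<odot> x \<odot> cl_vec v \<in> so_alg"
proof (rule linear_maps_so_alg[OF _ _ x])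
  show "linear (\<lambda>x. cl_vec v \<odot> x \<odot> cl_vec v)"
    by (rule linearI) (simp_all add: cl.add_left cl.add_right cl.scaleR_left cl.scaleR_right)
  fix p q
  define r where "r u = cl_vec v \<odot> cl_vec u \<odot> cl_vec v" for u
  have r: "r u = cl_vec (u - (2 * (v \<bullet> u)) *\<^sub>R v)" for u
  proof -
    have "r u = - (cl_vec u \<odot> (cl_vec v \<odot> cl_vec v)) - (2 * (v \<bullet> u)) *\<^sub>R cl_vec v"
      unfolding r_def cl_vec_anticommute[of v u]
      by (simp add: cl.diff_left cl.minus_left cl.scaleR_left cl_mult_assoc)
    then show ?thesis
      by (simp add: cl_vec_unit_square[OF v] cl.minus_right linear_diff[OF linear_cl_vec]
          linear_cmul[OF linear_cl_vec])
  qed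
  have *: "cl_vec v \<odot> (cl_vec a \<odot> cl_vec b) \<odot> cl_vec v = - (r a \<odot> r b)" for a b
  proof -
    have "r a \<odot> r b = cl_vec v \<odot> cl_vec a \<odot> (cl_vec v \<odot> cl_vec v) \<odot> cl_vec b \<odot> cl_vec v"
      by (simp add: r_def cl_mult_assoc)
    then show ?thesis
      by (simp add: cl_vec_unit_square[OF v] cl.minus_left cl.minus_right cl_mult_assoc)
  qed
  have "cl_vec v \<odot> commutator (cl_vec p) (cl_vec q) \<odot> cl_vec v = - commutator (r p) (r q)"
    by (simp add: commutator_def cl.diff_left cl.diff_right *)
  then show "cl_vec v \<odot> commutator (cl_vec p) (cl_vec q) \<odot> cl_vec v \<in> so_alg"
    unfolding r by (simp add: commutator_cl_vec_mem)
qed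

section \<open>The adjoint action on bivectors\<close>

lemma Ad_spin_group: "g \<in> spin_group \<Longrightarrow> Ad g x = g \<odot> x \<odot> cl_conj g"
  by (simp add: Ad_def cl_inverse_spin_group)

text \<open>The last two unit vectors of a group element act first, as two reflections, and their
  conjugation signs cancel. The induction varies \<open>x\<close> because its hypothesis is applied
  to the reflected bivector.\<close>

lemma Ad_so_alg [simp]:
  assumes "g \<in> spin_group" "x \<in> so_alg"
  shows "Ad g x \<in> so_alg"
proof -
  from assms have "g \<odot> x \<odot> cl_conj g \<in> so_alg"
  proof (induction arbitrary: x)
    case (step g v w)
    show ?case
      using step.IH[OF reflection_so_alg[OF step.hyps(2) reflection_so_alg[OF step.hyps(3) step.prems]]]
      by (simp add: cl_conj_mult cl_conj_vec cl.minus_left cl.minus_right cl_mult_assoc)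
  qed (simp add: cl_conj_one)
  then show ?thesis by (simp add: Ad_spin_group assms)
qed

text \<open>Stability under the inverse of \<open>Ad g\<close>, needed to invert the matrix. The
  induction is repeated instead of proving the group closed under inverses; here the new vectors act
  last.\<close>

lemma conj_so_alg:
  assumes "g \<in> spin_group" "x \<in> so_alg"
  shows "cl_conj g \<odot> x \<odot> g \<in> so_alg"
  using assms
proof (induction arbitrary: x)
  case (step g v w)
  show ?case
    using reflection_so_alg[OF step.hyps(3) reflection_so_alg[OF step.hyps(2) step.IH[OF step.prems]]]
    by (simp add: cl_conj_mult cl_conj_vec cl.minus_left cl.minus_right cl_mult_assoc)
qed (simp add: cl_conj_one)

lemma linear_Ad: "linear (Ad g)"
  by (rule linearI) (simp_all add: Ad_def cl.add_left cl.add_right cl.scaleR_left cl.scaleR_right)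

lemma Ad_commutator:
  assumes g: "g \<in> spin_group"
  shows "Ad g (commutator x y) = commutator (Ad g x) (Ad g y)"
proof -
  have "Ad g x \<odot> Ad g y = g \<odot> x \<odot> (cl_conj g \<odot> g) \<odot> y \<odot> cl_conj g" for x y
    by (simp add: Ad_spin_group[OF g] cl_mult_assoc)
  then show ?thesis
    by (simp add: commutator_def Ad_spin_group[OF g] spin_group_conj[OF g] cl.diff_left cl.diff_right
        cl_mult_assoc)
qed

section \<open>Invariant forms\<close>

text \<open>\<open>B\<close> is a total function, but \<open>invariant_form\<close> controls it on
  \<open>so_alg\<close> only. All rules therefore carry membership premises, which the closure rules
  for \<open>so_alg\<close> discharge.\<close>

locale invariant_so_form =
  fixes B :: "'n::{finite,linorder} cl \<Rightarrow> 'n cl \<Rightarrow> real"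
  assumes invariant_form: "invariant_form B"
begin

lemma form_sym: "x \<in> so_alg \<Longrightarrow> y \<in> so_alg \<Longrightarrow> B x y = B y x"
  using invariant_form unfolding invariant_form_def by blast

lemma form_invariant:
  "x \<in> so_alg \<Longrightarrow> y \<in> so_alg \<Longrightarrow> z \<in> so_alg \<Longrightarrow> B (commutator x y) z = B x (commutator y z)"
  using invariant_form unfolding invariant_form_def by blast

lemma form_add_left:
  "x \<in> so_alg \<Longrightarrow> y \<in> so_alg \<Longrightarrow> z \<in> so_alg \<Longrightarrow> B (x + y) z = B x z + B y z"
  using invariant_form unfolding invariant_form_def by blast

lemma form_scale_left: "x \<in> so_alg \<Longrightarrow> y \<in> so_alg \<Longrightarrow> B (c *\<^sub>R x) y = c * B x y"
  using invariant_form unfolding invariant_form_def by blast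

lemma form_add_right:
  "x \<in> so_alg \<Longrightarrow> y \<in> so_alg \<Longrightarrow> z \<in> so_alg \<Longrightarrow> B z (x + y) = B z x + B z y"
  by (simp add: form_sym[of z] form_add_left)

lemma form_scale_right: "x \<in> so_alg \<Longrightarrow> y \<in> so_alg \<Longrightarrow> B y (c *\<^sub>R x) = c * B y x"
  by (simp add: form_sym[of y] form_scale_left)

lemma form_minus_left: "x \<in> so_alg \<Longrightarrow> y \<in> so_alg \<Longrightarrow> B (- x) y = - B x y"
  using form_scale_left[of x y "-1"] by simp

lemma form_minus_right: "x \<in> so_alg \<Longrightarrow> y \<in> so_alg \<Longrightarrow> B y (- x) = - B y x"
  by (simp add: form_sym[of y] form_minus_left)

lemma form_zero: "x \<in> so_alg \<Longrightarrow> B 0 x = 0" "x \<in> so_alg \<Longrightarrow> B x 0 = 0"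
  using form_scale_left[of 0 x 0] form_scale_right[of 0 x 0] by simp_all

lemma form_diff_left:
  "x \<in> so_alg \<Longrightarrow> y \<in> so_alg \<Longrightarrow> z \<in> so_alg \<Longrightarrow> B (x - y) z = B x z - B y z"
  using form_add_left[of x "- y" z] by (simp add: form_minus_left)

lemma form_diff_right:
  "x \<in> so_alg \<Longrightarrow> y \<in> so_alg \<Longrightarrow> z \<in> so_alg \<Longrightarrow> B z (x - y) = B z x - B z y"
  by (simp add: form_sym[of z] form_diff_left)

lemmas form_simps =
  form_add_left form_add_right form_diff_left form_diff_right form_minus_left form_minus_right
  form_scale_left form_scale_right form_zero

lemma form_skew:
  assumes "x \<in> so_alg" "y \<in> so_alg" "z \<in> so_alg"
  shows "B (commutator z x) y = - B x (commutator z y)"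
  by (simp add: commutator_flip[of z x] form_minus_left form_invariant assms)

text \<open>Since D is skew for \<open>B\<close>, the adjoint of r = 1 - c D + D^2/2 is 1 + c D +
  D^2/2. Their product is 1 + (1 - c^2) D^2 + D^4/4, and this is 1 because D^4 = 4 (c^2 - 1)
  D^2.\<close>

lemma form_reflection_pair:
  assumes v: "norm v = 1" and w: "norm w = 1" and x: "x \<in> so_alg" and y: "y \<in> so_alg"
  defines "r \<equiv> \<lambda>x. cl_vec v \<odot> (cl_vec w \<odot> x \<odot> cl_vec w) \<odot> cl_vec v"
  shows "B (r x) (r y) = B x y"
proof -
  define c where "c = v \<bullet> w"
  define E where "E = (1/2) *\<^sub>R commutator (cl_vec v) (cl_vec w)"
  define D where "D = commutator E"
  have E: "E \<in> so_alg" by (simp add: E_def commutator_cl_vec_mem)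
  \<comment> \<open>E is the antisymmetric part of the product v w, and -c its symmetric
    part.\<close>
  have vw: "cl_vec v \<odot> cl_vec w = E - c *\<^sub>R cl_one" and wv: "cl_vec w \<odot> cl_vec v = - E - c *\<^sub>R cl_one"
    using cl_vec_anticommute[of v w]
    by (simp_all add: E_def c_def commutator_def vec_eq_iff field_simps)
      (simp add: eq_neg_iff_add_eq_0 ac_simps)
  \<comment> \<open>From (v w)(w v) = 1 it follows that E E is the scalar c^2 - 1; this is what
    makes D satisfy a cubic equation.\<close>
  have "cl_vec v \<odot> cl_vec w \<odot> (cl_vec w \<odot> cl_vec v) = cl_vec v \<odot> (cl_vec w \<odot> cl_vec w) \<odot> cl_vec v"
    by (simp add: cl_mult_assoc)
  then have "(E - c *\<^sub>R cl_one) \<odot> (- E - c *\<^sub>R cl_one) = cl_one"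
    unfolding vw wv by (simp add: cl_vec_unit_square v w cl.minus_left cl.minus_right)
  then have EE: "E \<odot> E = (c\<^sup>2 - 1) *\<^sub>R cl_one"
    by (simp add: cl.diff_left cl.diff_right cl.minus_right cl.scaleR_left cl.scaleR_right algebra_simps
        power2_eq_square)
  have EEx: "E \<odot> (E \<odot> x) = (c\<^sup>2 - 1) *\<^sub>R x" for x
    by (simp add: EE cl.scaleR_left flip: cl_mult_assoc)
  have D2: "D (D x) = 2 *\<^sub>R ((c\<^sup>2 - 1) *\<^sub>R x - E \<odot> x \<odot> E)" for x
    by (simp add: D_def commutator_def cl.diff_left cl.diff_right cl_mult_assoc EE EEx cl.scaleR_right)
      (simp add: vec_eq_iff algebra_simps)
  have D3: "D (D (D x)) = (4 * (c\<^sup>2 - 1)) *\<^sub>R D x" for x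
  proof -
    have "D (D (D x)) = 2 *\<^sub>R ((c\<^sup>2 - 1) *\<^sub>R D x - D (E \<odot> x \<odot> E))"
      unfolding D2[of x] by (simp add: D_def comm.scaleR_right comm.diff_right)
    also have "D (E \<odot> x \<odot> E) = - (c\<^sup>2 - 1) *\<^sub>R D x"
      by (simp add: D_def commutator_def cl_mult_assoc EE EEx cl.scaleR_right)
        (simp add: vec_eq_iff algebra_simps)
    finally show ?thesis by (simp add: vec_eq_iff algebra_simps)
  qed
  have r: "r x = x - c *\<^sub>R D x + (1/2) *\<^sub>R D (D x)" for x
  proof -
    have "r x = (cl_vec v \<odot> cl_vec w) \<odot> x \<odot> (cl_vec w \<odot> cl_vec v)"
      by (simp add: r_def cl_mult_assoc)
    then show ?thesis
      unfolding vw wv D2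
      by (simp add: D_def commutator_def cl.diff_left cl.diff_right cl.minus_right cl.scaleR_left
          cl.scaleR_right algebra_simps power2_eq_square)
  qed
  have mem: "D z \<in> so_alg" if "z \<in> so_alg" for z using that E by (simp add: D_def)
  have skew: "B (D z) z' = - B z (D z')" if "z \<in> so_alg" "z' \<in> so_alg" for z z'
    using that E by (simp add: D_def form_skew)
  show ?thesis
    by (simp add: r form_simps mem x y skew D3)
      (simp add: field_simps power2_eq_square)
qed

lemma form_Ad:
  assumes "g \<in> spin_group" "x \<in> so_alg" "y \<in> so_alg"
  shows "B (Ad g x) (Ad g y) = B x y"
proof -
  from assms have "B (g \<odot> x \<odot> cl_conj g) (g \<odot> y \<odot> cl_conj g) = B x y"
  proof (induction arbitrary: x y)
    case (step g v w)
    define r where "r \<equiv> \<lambda>x. cl_vec v \<odot> (cl_vec w \<odot> x \<odot> cl_vec w) \<odot> cl_vec v"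
    have mem: "r x \<in> so_alg" if "x \<in> so_alg" for x
      using that step.hyps by (simp add: r_def reflection_so_alg)
    have "(g \<odot> cl_vec v \<odot> cl_vec w) \<odot> x \<odot> cl_conj (g \<odot> cl_vec v \<odot> cl_vec w) = g \<odot> r x \<odot> cl_conj g" for x
      by (simp add: r_def cl_conj_mult cl_conj_vec cl.minus_left cl.minus_right cl_mult_assoc)
    then show ?case
      using step form_reflection_pair[of v w x y] by (simp add: mem) (simp add: r_def)
  qed (simp add: cl_conj_one)
  then show ?thesis by (simp add: Ad_spin_group assms)
qed

text \<open>Projecting both arguments to the bivector coordinates gives a form that is bilinear on
  the whole Clifford algebra, so that smoothness and the product rule for bounded bilinear maps
  apply to \<open>B\<close>.\<close>

lemma bilinear_extension:
  obtains B' :: "'n cl \<Rightarrow> 'n cl \<Rightarrow> real"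
  where "bounded_bilinear B'" "\<And>x y. x \<in> so_alg \<Longrightarrow> y \<in> so_alg \<Longrightarrow> B' x y = B x y"
proof
  define P :: "'n cl \<Rightarrow> 'n cl" where "P x = (\<chi> S. if card S = 2 then x $ S else 0)" for x
  have P: "P x \<in> so_alg" "P (x + y) = P x + P y" "P (c *\<^sub>R x) = c *\<^sub>R P x" for x y c
    by (simp_all add: P_def mem_so_alg_iff vec_eq_iff)
  have "bilinear (\<lambda>x y. B (P x) (P y))"
    unfolding bilinear_def by (auto intro!: linearI simp: P form_simps)
  then show "bounded_bilinear (\<lambda>x y. B (P x) (P y))"
    by (simp add: bilinear_conv_bounded_bilinear)
  have "P x = x" if "x \<in> so_alg" for x
    using that by (simp add: P_def mem_so_alg_iff vec_eq_iff)
  then show "B (P x) (P y) = B x y" if "x \<in> so_alg" "y \<in> so_alg" for x y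
    using that by simp
qed

lemma form_cycle:
  "x \<in> so_alg \<Longrightarrow> y \<in> so_alg \<Longrightarrow> z \<in> so_alg \<Longrightarrow> B y (commutator z x) = B x (commutator y z)"
  using form_invariant[of y z x] form_sym[of "commutator y z" x] by simp

lemma form_swap:
  "x \<in> so_alg \<Longrightarrow> y \<in> so_alg \<Longrightarrow> z \<in> so_alg \<Longrightarrow> B x (commutator z y) = - B x (commutator y z)"
  by (simp add: commutator_flip[of z y] form_minus_right)

text \<open>The trilinear form \<open>B x (commutator y z)\<close> is alternating. Instantiated at a
  triple in a chosen order, these equations rewrite every cubic term in it to one normal
  form.\<close>

lemma form_permute:
  assumes "x \<in> so_alg" "y \<in> so_alg" "z \<in> so_alg"
  shows "B y (commutator z x) = B x (commutator y z)" "B z (commutator x y) = B x (commutator y z)"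
    "B x (commutator z y) = - B x (commutator y z)" "B y (commutator x z) = - B x (commutator y z)"
    "B z (commutator y x) = - B x (commutator y z)"
  using form_cycle[of x y z] form_cycle[of z x y] form_swap[of x y z] form_swap[of y z x] form_swap[of z x y]
    assms by simp_all

text \<open>The transgression formula at a point. The letters m, n, p and a, b, c are the values of
  \<mu> and \<theta>0 on X, Y, Z; u, v, w are those of d\<theta>0 on (Y, Z), (X, Z), (X, Y). The
  brackets added to u, v, w come from applying Ad to d\<theta>1.\<close>

lemma chern_simons_gauge_algebra:
  assumes mem: "m \<in> so_alg" "n \<in> so_alg" "p \<in> so_alg" "a \<in> so_alg" "b \<in> so_alg" "c \<in> so_alg"
    "u \<in> so_alg" "v \<in> so_alg" "w \<in> so_alg"
  shows "B (a + m) (u + commutator n p - commutator n (c + p) + commutator p (b + n))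
      - B (b + n) (v + commutator m p - commutator m (c + p) + commutator p (a + m))
      + B (c + p) (w + commutator m n - commutator m (b + n) + commutator n (a + m))
      + 2 * B (a + m) (commutator (b + n) (c + p))
      - (B a u - B b v + B c w + 2 * B a (commutator b c))
    = (B m u - B n v + B p w)
      - (B a (commutator n p) - B b (commutator m p) + B c (commutator m n)) - B m (commutator n p)"
proof -
  \<comment> \<open>One reference order for each of the eight choices from m or a, n or b, p or
    c.\<close>
  note T = form_permute[of m n p] form_permute[of a n p] form_permute[of m b p] form_permute[of m n c]
    form_permute[of m b c] form_permute[of a n c] form_permute[of a b p] form_permute[of a b c]
  show ?thesis
    by (simp add: form_simps comm.add_left comm.add_right mem T)
qed

end

section \<open>Calculus over an algebra of functions\<close>

text \<open>Derivations and forms are handled algebraically, over any set of real functions that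
  contains the constants and is closed under sums and products.\<close>

locale function_algebra =
  fixes C :: "('u \<Rightarrow> real) set"
  assumes const_mem [simp]: "(\<lambda>x. c) \<in> C"
    and add_mem [simp]: "f \<in> C \<Longrightarrow> h \<in> C \<Longrightarrow> (\<lambda>x. f x + h x) \<in> C"
    and mult_mem [simp]: "f \<in> C \<Longrightarrow> h \<in> C \<Longrightarrow> (\<lambda>x. f x * h x) \<in> C"
begin

lemma uminus_mem [simp]: "f \<in> C \<Longrightarrow> (\<lambda>x. - f x) \<in> C"
  using mult_mem[OF const_mem[of "-1"], of f] by simp

lemma diff_mem [simp]: "f \<in> C \<Longrightarrow> h \<in> C \<Longrightarrow> (\<lambda>x. f x - h x) \<in> C"
  using add_mem[of f "\<lambda>x. - h x"] by simp

lemma sum_mem [simp]: "(\<And>i. i \<in> I \<Longrightarrow> f i \<in> C) \<Longrightarrow> (\<lambda>x. \<Sum>i\<in>I. f i x) \<in> C"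
  by (induction I rule: infinite_finite_induct) auto

section \<open>Vector fields as derivations, their bracket and its Jacobi identity\<close>

lemma vf_mem: "X \<in> vector_fields C \<Longrightarrow> f \<in> C \<Longrightarrow> X f \<in> C"
  by (simp add: vector_fields_def)

lemma vf_outside: "X \<in> vector_fields C \<Longrightarrow> f \<notin> C \<Longrightarrow> X f = 0"
  by (simp add: vector_fields_def)

lemma vf_add:
  "X \<in> vector_fields C \<Longrightarrow> f \<in> C \<Longrightarrow> h \<in> C \<Longrightarrow> X (\<lambda>x. f x + h x) = (\<lambda>x. X f x + X h x)"
  unfolding vector_fields_def plus_fun_def by blast

lemma vf_scale:
  "X \<in> vector_fields C \<Longrightarrow> f \<in> C \<Longrightarrow> X (\<lambda>x. c * f x) = (\<lambda>x. c * X f x)"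
  unfolding vector_fields_def by blast

lemma vf_mult:
  "X \<in> vector_fields C \<Longrightarrow> f \<in> C \<Longrightarrow> h \<in> C \<Longrightarrow> X (\<lambda>x. f x * h x) = (\<lambda>x. f x * X h x + h x * X f x)"
  unfolding vector_fields_def plus_fun_def times_fun_def by blast

lemma vf_uminus: "X \<in> vector_fields C \<Longrightarrow> f \<in> C \<Longrightarrow> X (\<lambda>x. - f x) = (\<lambda>x. - X f x)"
  using vf_scale[of X f "-1"] by simp

lemma vf_diff:
  "X \<in> vector_fields C \<Longrightarrow> f \<in> C \<Longrightarrow> h \<in> C \<Longrightarrow> X (\<lambda>x. f x - h x) = (\<lambda>x. X f x - X h x)"
  using vf_add[of X f "\<lambda>x. - h x"] vf_uminus[of X h] by simp

lemma vf_const: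
  assumes "X \<in> vector_fields C"
  shows "X (\<lambda>x. c) = (\<lambda>x. 0)"
proof -
  have "X (\<lambda>x. 1) = (\<lambda>x. X (\<lambda>x. 1) x + X (\<lambda>x. 1) x)"
    using vf_mult[OF assms, of "\<lambda>x. 1" "\<lambda>x. 1"] by simp
  then have "X (\<lambda>x. 1) = (\<lambda>x. 0)" by (simp add: fun_eq_iff)
  then show ?thesis using vf_scale[OF assms, of "\<lambda>x. 1" c] by simp
qed

lemma vf_sum:
  assumes "X \<in> vector_fields C" and "\<And>i. i \<in> I \<Longrightarrow> f i \<in> C"
  shows "X (\<lambda>x. \<Sum>i\<in>I. f i x) = (\<lambda>x. \<Sum>i\<in>I. X (f i) x)"
  using assms(2)
proof (induction I rule: infinite_finite_induct)
  case (insert i I)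
  then show ?case using vf_add[OF assms(1), of "f i" "\<lambda>x. \<Sum>i\<in>I. f i x"] by simp
qed (simp_all add: vf_const[OF assms(1)])

lemma vf_bracket_mem [simp]:
  assumes X: "X \<in> vector_fields C" and Y: "Y \<in> vector_fields C"
  shows "vf_bracket X Y \<in> vector_fields C"
  unfolding vector_fields_def mem_Collect_eq
proof (intro conjI ballI allI impI)
  note simps = vf_bracket_def plus_fun_def times_fun_def fun_diff_def zero_fun_def
    vf_add[OF X] vf_add[OF Y] vf_mult[OF X] vf_mult[OF Y] vf_scale[OF X] vf_scale[OF Y] vf_mem[OF X] vf_mem[OF Y]
  show "vf_bracket X Y f \<in> C" if "f \<in> C" for f
    using that by (simp add: simps)
  \<comment> \<open>Outside \<open>C\<close> both inner values are the zero function, which lies in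
    \<open>C\<close> and is killed by every derivation.\<close>
  show "vf_bracket X Y f = 0" if "f \<notin> C" for f
    using that vf_const[OF X, of 0] vf_const[OF Y, of 0]
    by (simp add: simps vf_outside[OF X, unfolded zero_fun_def] vf_outside[OF Y, unfolded zero_fun_def])
  show "vf_bracket X Y (f + h) = vf_bracket X Y f + vf_bracket X Y h" if "f \<in> C" "h \<in> C" for f h
    using that by (simp add: simps fun_eq_iff)
  show "vf_bracket X Y (\<lambda>x. c * f x) = (\<lambda>x. c * vf_bracket X Y f x)" if "f \<in> C" for f c
    using that by (simp add: vf_bracket_def fun_diff_def vf_scale[OF X] vf_scale[OF Y] vf_mem[OF X] vf_mem[OF Y] right_diff_distrib)
  show "vf_bracket X Y (f * h) = f * vf_bracket X Y h + h * vf_bracket X Y f" if "f \<in> C" "h \<in> C" for f h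
    using that by (simp add: simps fun_eq_iff algebra_simps)
qed

lemma vf_add_mem [simp]:
  assumes X: "X \<in> vector_fields C" and Y: "Y \<in> vector_fields C"
  shows "X + Y \<in> vector_fields C"
  using assms unfolding vector_fields_def mem_Collect_eq plus_fun_def times_fun_def
  by (auto simp: fun_eq_iff algebra_simps)

lemma vf_scale_mem:
  assumes h: "h \<in> C" and X: "X \<in> vector_fields C"
  shows "(\<lambda>f. h * X f) \<in> vector_fields C"
  unfolding vector_fields_def mem_Collect_eq
proof (intro conjI ballI allI impI)
  note simps = fun_eq_iff times_fun_def plus_fun_def algebra_simps h vf_mem[OF X]
    vf_add[OF X] vf_mult[OF X] vf_scale[OF X]
  show "h * X f \<in> C" if "f \<in> C" for f
    using that by (simp add: times_fun_def h vf_mem[OF X])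
  show "h * X f = 0" if "f \<notin> C" for f
    using that by (simp add: vf_outside[OF X])
  show "h * X (f + f') = h * X f + h * X f'" if "f \<in> C" "f' \<in> C" for f f'
    using that by (simp add: simps)
  show "h * X (\<lambda>x. c * f x) = (\<lambda>x. c * (h * X f) x)" if "f \<in> C" for f c
    using that by (simp add: vf_scale[OF X] fun_eq_iff)
  show "h * X (f * f') = f * (h * X f') + f' * (h * X f)" if "f \<in> C" "f' \<in> C" for f f'
    using that by (simp add: simps)
qed

text \<open>The Jacobi identity arranged as the double brackets occur in
  \<open>d2_d1\<close>.\<close>

lemma vf_jacobi:
  assumes X: "X \<in> vector_fields C" and Y: "Y \<in> vector_fields C" and Z: "Z \<in> vector_fields C"
  shows "vf_bracket (vf_bracket X Y) Z + vf_bracket (vf_bracket Y Z) X = vf_bracket (vf_bracket X Z) Y"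
proof
  fix f
  show "(vf_bracket (vf_bracket X Y) Z + vf_bracket (vf_bracket Y Z) X) f = vf_bracket (vf_bracket X Z) Y f"
  proof (cases "f \<in> C")
    case True
    then show ?thesis
      by (simp add: vf_bracket_def fun_diff_def plus_fun_def vf_mem[OF X] vf_mem[OF Y] vf_mem[OF Z] vf_diff[OF X] vf_diff[OF Y] vf_diff[OF Z])
        (simp add: fun_eq_iff)
  next
    case False
    then show ?thesis by (simp add: vf_outside X Y Z plus_fun_def zero_fun_def)
  qed
qed

section \<open>Smooth vector-valued maps and their derivatives\<close>

lemma smooth_map_comp: "f \<in> smooth_maps C W \<Longrightarrow> b \<in> Basis \<Longrightarrow> (\<lambda>x. f x \<bullet> b) \<in> C"
  by (simp add: smooth_maps_def)

lemma smooth_mapI: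
  "(\<And>x. f x \<in> W) \<Longrightarrow> (\<And>b. b \<in> Basis \<Longrightarrow> (\<lambda>x. f x \<bullet> b) \<in> C) \<Longrightarrow> f \<in> smooth_maps C W"
  by (simp add: smooth_maps_def)

lemma smooth_map_mem: "f \<in> smooth_maps C W \<Longrightarrow> f x \<in> W"
  by (simp add: smooth_maps_def)

lemma smooth_maps_iff: "f \<in> smooth_maps C W \<longleftrightarrow> f \<in> smooth_maps C UNIV \<and> (\<forall>x. f x \<in> W)"
  by (auto simp: smooth_maps_def)

lemma smooth_maps_real [simp]: "f \<in> smooth_maps C (UNIV :: real set) \<longleftrightarrow> f \<in> C"
  by (simp add: smooth_maps_def)

lemma smooth_maps_add [simp]:
  "f \<in> smooth_maps C UNIV \<Longrightarrow> h \<in> smooth_maps C UNIV \<Longrightarrow> (\<lambda>x. f x + h x) \<in> smooth_maps C UNIV"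
  by (simp add: smooth_maps_def inner_add_left)

lemma smooth_maps_diff [simp]:
  "f \<in> smooth_maps C UNIV \<Longrightarrow> h \<in> smooth_maps C UNIV \<Longrightarrow> (\<lambda>x. f x - h x) \<in> smooth_maps C UNIV"
  by (simp add: smooth_maps_def inner_diff_left)

text \<open>In coordinates a bilinear map is a finite sum of products with constant coefficients;
  smoothness and the Leibniz rule then reduce to those for functions in \<open>C\<close>.\<close>

lemma bilinear_coefficients:
  fixes h :: "'a::euclidean_space \<Rightarrow> 'b::euclidean_space \<Rightarrow> 'c::euclidean_space"
  assumes "bounded_bilinear h"
  obtains k where "\<And>a b. h a b \<bullet> c = (\<Sum>i\<in>Basis. \<Sum>j\<in>Basis. k i j * ((a \<bullet> i) * (b \<bullet> j)))"
proof
  interpret h: bounded_bilinear h by fact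
  fix a b
  have "h a b = h (\<Sum>i\<in>Basis. (a \<bullet> i) *\<^sub>R i) (\<Sum>j\<in>Basis. (b \<bullet> j) *\<^sub>R j)"
    by (simp add: euclidean_representation)
  then show "h a b \<bullet> c = (\<Sum>i\<in>Basis. \<Sum>j\<in>Basis. (h i j \<bullet> c) * ((a \<bullet> i) * (b \<bullet> j)))"
    by (simp only: h.sum_left h.sum_right h.scaleR_left h.scaleR_right inner_sum_left inner_scaleR_left
        scaleR_scaleR sum_distrib_left ac_simps)
      (rule sum.swap)
qed

lemma smooth_maps_bilinear:
  fixes h :: "'a::euclidean_space \<Rightarrow> 'b::euclidean_space \<Rightarrow> 'c::euclidean_space"
  assumes "bounded_bilinear h" and a: "a \<in> smooth_maps C UNIV" and b: "b \<in> smooth_maps C UNIV"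
  shows "(\<lambda>x. h (a x) (b x)) \<in> smooth_maps C UNIV"
proof (rule smooth_mapI)
  fix c :: 'c
  obtain k where k: "\<And>a b. h a b \<bullet> c = (\<Sum>i\<in>Basis. \<Sum>j\<in>Basis. k i j * ((a \<bullet> i) * (b \<bullet> j)))"
    using bilinear_coefficients[OF assms(1)] by blast
  show "(\<lambda>x. h (a x) (b x) \<bullet> c) \<in> C"
    unfolding k by (simp add: smooth_map_comp[OF a] smooth_map_comp[OF b])
qed simp

lemma smooth_maps_cl_mult [simp]:
  "a \<in> smooth_maps C UNIV \<Longrightarrow> b \<in> smooth_maps C UNIV \<Longrightarrow> (\<lambda>x. a x \<odot> b x) \<in> smooth_maps C UNIV"
  by (rule smooth_maps_bilinear[OF cl_mult_bilinear])

lemma deriv_along_inner: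
  "b \<in> Basis \<Longrightarrow> deriv_along X f x \<bullet> b = X (\<lambda>y. f y \<bullet> b) x"
  by (simp add: deriv_along_def inner_sum_left inner_Basis sum.delta' if_distrib cong: if_cong)

lemma deriv_along_mem [simp]:
  "X \<in> vector_fields C \<Longrightarrow> f \<in> smooth_maps C UNIV \<Longrightarrow> deriv_along X f \<in> smooth_maps C UNIV"
  by (simp add: smooth_maps_def deriv_along_inner vf_mem)

lemma deriv_along_add:
  assumes "X \<in> vector_fields C" "f \<in> smooth_maps C UNIV" "h \<in> smooth_maps C UNIV"
  shows "deriv_along X (\<lambda>x. f x + h x) = (\<lambda>x. deriv_along X f x + deriv_along X h x)"
  by (rule ext, rule euclidean_eqI) (simp add: deriv_along_inner inner_add_left vf_add[OF assms(1)]
      smooth_map_comp[OF assms(2)] smooth_map_comp[OF assms(3)])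

lemma deriv_along_diff:
  assumes "X \<in> vector_fields C" "f \<in> smooth_maps C UNIV" "h \<in> smooth_maps C UNIV"
  shows "deriv_along X (\<lambda>x. f x - h x) = (\<lambda>x. deriv_along X f x - deriv_along X h x)"
  by (rule ext, rule euclidean_eqI) (simp add: deriv_along_inner inner_diff_left vf_diff[OF assms(1)]
      smooth_map_comp[OF assms(2)] smooth_map_comp[OF assms(3)])

lemma deriv_along_const:
  assumes "X \<in> vector_fields C"
  shows "deriv_along X (\<lambda>x. c) = (\<lambda>x. 0)"
  by (rule ext, rule euclidean_eqI) (simp add: deriv_along_inner vf_const[OF assms])

lemma deriv_along_vf_bracket:
  "deriv_along (vf_bracket X Y) f x
    = deriv_along X (deriv_along Y f) x - deriv_along Y (deriv_along X f) x"
  by (rule euclidean_eqI)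
    (simp add: deriv_along_inner inner_diff_left vf_bracket_def)

lemma deriv_along_bilinear:
  fixes h :: "'a::euclidean_space \<Rightarrow> 'b::euclidean_space \<Rightarrow> 'c::euclidean_space"
  assumes h: "bounded_bilinear h" and X: "X \<in> vector_fields C"
    and a: "a \<in> smooth_maps C UNIV" and b: "b \<in> smooth_maps C UNIV"
  shows "deriv_along X (\<lambda>x. h (a x) (b x)) = (\<lambda>x. h (deriv_along X a x) (b x) + h (a x) (deriv_along X b x))"
proof (rule ext, rule euclidean_eqI)
  fix x and c :: 'c assume c: "c \<in> Basis"
  obtain k where k: "\<And>a b. h a b \<bullet> c = (\<Sum>i\<in>Basis. \<Sum>j\<in>Basis. k i j * ((a \<bullet> i) * (b \<bullet> j)))"
    using bilinear_coefficients[OF h] by blast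
  have "X (\<lambda>y. h (a y) (b y) \<bullet> c) x
      = (\<Sum>i\<in>Basis. \<Sum>j\<in>Basis. k i j * ((a x \<bullet> i) * X (\<lambda>y. b y \<bullet> j) x + (b x \<bullet> j) * X (\<lambda>y. a y \<bullet> i) x))"
    by (simp add: k vf_sum[OF X] vf_mult[OF X] vf_const[OF X]
        smooth_map_comp[OF a] smooth_map_comp[OF b])
  then show "deriv_along X (\<lambda>x. h (a x) (b x)) x \<bullet> c
      = (h (deriv_along X a x) (b x) + h (a x) (deriv_along X b x)) \<bullet> c"
    using c by (simp add: deriv_along_inner inner_add_left k
        sum.distrib algebra_simps)
qed

text \<open>\<open>so_alg\<close> is cut out by the vanishing of coordinates, and the derivative of
  a vanishing coordinate vanishes.\<close>

lemma deriv_along_so_alg: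
  assumes X: "X \<in> vector_fields C" and a: "a \<in> smooth_maps C so_alg"
  shows "deriv_along X a x \<in> so_alg"
proof -
  have "deriv_along X a x $ S = 0" if "card S \<noteq> 2" for S
  proof -
    have "a y $ S = 0" for y
      using that smooth_map_mem[OF a] by (simp add: mem_so_alg_iff)
    then show ?thesis
      using deriv_along_inner[of "axis S 1" X a x] by (simp add: inner_axis vf_const[OF X])
  qed
  then show ?thesis by (simp add: mem_so_alg_iff)
qed

lemma smooth_maps_UNIV: "f \<in> smooth_maps C W \<Longrightarrow> f \<in> smooth_maps C UNIV"
  by (simp add: smooth_maps_def)

lemma smooth_maps_subspace_add:
  "subspace W \<Longrightarrow> f \<in> smooth_maps C W \<Longrightarrow> h \<in> smooth_maps C W \<Longrightarrow> (\<lambda>x. f x + h x) \<in> smooth_maps C W"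
  by (simp add: smooth_maps_def inner_add_left subspace_add)

lemma smooth_maps_subspace_diff:
  "subspace W \<Longrightarrow> f \<in> smooth_maps C W \<Longrightarrow> h \<in> smooth_maps C W \<Longrightarrow> (\<lambda>x. f x - h x) \<in> smooth_maps C W"
  by (simp add: smooth_maps_def inner_diff_left subspace_diff)

section \<open>Differential forms and the exterior derivative\<close>

lemma forms1_smooth: "\<theta> \<in> forms1 C W \<Longrightarrow> X \<in> vector_fields C \<Longrightarrow> \<theta> X \<in> smooth_maps C W"
  by (simp add: forms1_def)

lemma forms1_outside: "\<theta> \<in> forms1 C W \<Longrightarrow> X \<notin> vector_fields C \<Longrightarrow> \<theta> X = 0"
  by (simp add: forms1_def)

text \<open>No condition on \<open>X\<close> is needed: off the vector fields the value is 0, which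
  a subspace contains.\<close>

lemma forms1_mem: "\<theta> \<in> forms1 C W \<Longrightarrow> subspace W \<Longrightarrow> \<theta> X x \<in> W"
  by (metis forms1_outside forms1_smooth smooth_map_mem subspace_0 zero_fun_apply)

lemma forms1_plus:
  "\<theta> \<in> forms1 C W \<Longrightarrow> X \<in> vector_fields C \<Longrightarrow> Y \<in> vector_fields C \<Longrightarrow> \<theta> (X + Y) = \<theta> X + \<theta> Y"
  by (simp add: forms1_def)

lemma forms1_scale:
  "\<theta> \<in> forms1 C W \<Longrightarrow> h \<in> C \<Longrightarrow> X \<in> vector_fields C \<Longrightarrow> \<theta> (\<lambda>f. h * X f) = (\<lambda>x. h x *\<^sub>R \<theta> X x)"
  by (simp add: forms1_def)

lemma forms1_add:
  assumes W: "subspace W" and \<theta>: "\<theta> \<in> forms1 C W" and \<eta>: "\<eta> \<in> forms1 C W"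
  shows "\<theta> + \<eta> \<in> forms1 C W"
  unfolding forms1_def mem_Collect_eq
proof (intro conjI ballI allI impI)
  show "(\<theta> + \<eta>) X \<in> smooth_maps C W" if "X \<in> vector_fields C" for X
    using smooth_maps_subspace_add[OF W forms1_smooth[OF \<theta> that] forms1_smooth[OF \<eta> that]]
    by (simp add: plus_fun_def fun_diff_def)
qed (simp_all add: forms1_outside[OF \<theta>] forms1_outside[OF \<eta>] forms1_plus[OF \<theta>] forms1_plus[OF \<eta>]
    forms1_scale[OF \<theta>] forms1_scale[OF \<eta>] fun_eq_iff scaleR_add_right)

lemma forms1_diff:
  assumes W: "subspace W" and \<theta>: "\<theta> \<in> forms1 C W" and \<eta>: "\<eta> \<in> forms1 C W"
  shows "\<theta> - \<eta> \<in> forms1 C W"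
  unfolding forms1_def mem_Collect_eq
proof (intro conjI ballI allI impI)
  show "(\<theta> - \<eta>) X \<in> smooth_maps C W" if "X \<in> vector_fields C" for X
    using smooth_maps_subspace_diff[OF W forms1_smooth[OF \<theta> that] forms1_smooth[OF \<eta> that]]
    by (simp add: plus_fun_def fun_diff_def)
qed (simp_all add: forms1_outside[OF \<theta>] forms1_outside[OF \<eta>] forms1_plus[OF \<theta>] forms1_plus[OF \<eta>]
    forms1_scale[OF \<theta>] forms1_scale[OF \<eta>] fun_eq_iff scaleR_diff_right)

lemma forms2_form1: "\<omega> \<in> forms2 C W \<Longrightarrow> X \<in> vector_fields C \<Longrightarrow> \<omega> X \<in> forms1 C W"
  unfolding forms2_def by blast

lemma forms2_outside: "\<omega> \<in> forms2 C W \<Longrightarrow> X \<notin> vector_fields C \<Longrightarrow> \<omega> X = 0"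
  unfolding forms2_def by blast

lemma forms2_flip: "\<omega> \<in> forms2 C W \<Longrightarrow> \<omega> X Y = - \<omega> Y X"
  unfolding forms2_def by blast

lemma forms2_smooth:
  "\<omega> \<in> forms2 C W \<Longrightarrow> X \<in> vector_fields C \<Longrightarrow> Y \<in> vector_fields C \<Longrightarrow> \<omega> X Y \<in> smooth_maps C W"
  using forms1_smooth forms2_form1 by blast

lemma forms2_add:
  assumes "\<omega> \<in> forms2 C UNIV" "\<omega>' \<in> forms2 C UNIV"
  shows "\<omega> + \<omega>' \<in> forms2 C UNIV"
  unfolding forms2_def mem_Collect_eq
proof (intro conjI ballI allI impI)
  show "(\<omega> + \<omega>') X \<in> forms1 C UNIV" if "X \<in> vector_fields C" for X
    using forms1_add[OF subspace_UNIV forms2_form1[OF assms(1) that] forms2_form1[OF assms(2) that]] by simp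
  show "(\<omega> + \<omega>') X = 0" if "X \<notin> vector_fields C" for X
    using that by (simp add: forms2_outside[OF assms(1)] forms2_outside[OF assms(2)])
  show "(\<omega> + \<omega>') X Y = - (\<omega> + \<omega>') Y X" for X Y
    by (simp add: forms2_flip[OF assms(1), of X Y] forms2_flip[OF assms(2), of X Y])
qed

lemma forms2_diff:
  assumes "\<omega> \<in> forms2 C UNIV" "\<omega>' \<in> forms2 C UNIV"
  shows "\<omega> - \<omega>' \<in> forms2 C UNIV"
  unfolding forms2_def mem_Collect_eq
proof (intro conjI ballI allI impI)
  show "(\<omega> - \<omega>') X \<in> forms1 C UNIV" if "X \<in> vector_fields C" for X
    using forms1_diff[OF subspace_UNIV forms2_form1[OF assms(1) that] forms2_form1[OF assms(2) that]] by simp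
  show "(\<omega> - \<omega>') X = 0" if "X \<notin> vector_fields C" for X
    using that by (simp add: forms2_outside[OF assms(1)] forms2_outside[OF assms(2)])
  show "(\<omega> - \<omega>') X Y = - (\<omega> - \<omega>') Y X" for X Y
    by (simp add: forms2_flip[OF assms(1), of X Y] forms2_flip[OF assms(2), of X Y])
qed

lemma d1_eq:
  "X \<in> vector_fields C \<Longrightarrow> Y \<in> vector_fields C \<Longrightarrow>
    d1 C \<theta> X Y = (\<lambda>x. deriv_along X (\<theta> Y) x - deriv_along Y (\<theta> X) x - \<theta> (vf_bracket X Y) x)"
  by (simp add: d1_def fun_diff_def)

lemma d1_smooth:
  assumes "\<theta> \<in> forms1 C UNIV" "X \<in> vector_fields C" "Y \<in> vector_fields C"
  shows "d1 C \<theta> X Y \<in> smooth_maps C UNIV"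
  using assms by (simp add: d1_eq forms1_smooth[OF assms(1)])

text \<open>Second derivatives cancel against the derivatives along brackets; what remains is
  \<open>A\<close> applied to the Jacobi identity.\<close>

lemma d2_d1:
  assumes A: "A \<in> forms1 C UNIV"
  shows "d2 C (d1 C A) = 0"
proof (intro ext)
  fix X Y Z x
  show "d2 C (d1 C A) X Y Z x = 0 X Y Z x"
  proof (cases "X \<in> vector_fields C \<and> Y \<in> vector_fields C \<and> Z \<in> vector_fields C")
    case True
    then have X: "X \<in> vector_fields C" and Y: "Y \<in> vector_fields C" and Z: "Z \<in> vector_fields C"
      by auto
    have "A (vf_bracket (vf_bracket X Y) Z) + A (vf_bracket (vf_bracket Y Z) X)
        = A (vf_bracket (vf_bracket X Z) Y)"
      using forms1_plus[OF A, of "vf_bracket (vf_bracket X Y) Z" "vf_bracket (vf_bracket Y Z) X"]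
      by (simp add: X Y Z vf_jacobi)
    then have "A (vf_bracket (vf_bracket X Y) Z) x + A (vf_bracket (vf_bracket Y Z) X) x
        = A (vf_bracket (vf_bracket X Z) Y) x"
      by (metis plus_fun_apply)
    then show ?thesis
      by (simp add: d2_def X Y Z forms1_smooth[OF A] d1_eq deriv_along_diff deriv_along_vf_bracket)
        (simp add: algebra_simps)
  qed (auto simp: d2_def)
qed

lemma d2_add:
  assumes "\<And>X Y. X \<in> vector_fields C \<Longrightarrow> Y \<in> vector_fields C \<Longrightarrow> \<omega> X Y \<in> smooth_maps C UNIV"
    and "\<And>X Y. X \<in> vector_fields C \<Longrightarrow> Y \<in> vector_fields C \<Longrightarrow> \<omega>' X Y \<in> smooth_maps C UNIV"
  shows "d2 C (\<omega> + \<omega>') = d2 C \<omega> + d2 C \<omega>'"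
proof (intro ext)
  fix X Y Z x
  show "d2 C (\<omega> + \<omega>') X Y Z x = (d2 C \<omega> + d2 C \<omega>') X Y Z x"
    by (simp add: d2_def plus_fun_def deriv_along_add assms)
qed

end

locale function_algebra_form = function_algebra C + invariant_so_form B
  for C :: "('u \<Rightarrow> real) set" and B :: "'n::{finite,linorder} cl \<Rightarrow> 'n cl \<Rightarrow> real"
begin

lemma form_smooth:
  assumes a: "a \<in> smooth_maps C so_alg" and b: "b \<in> smooth_maps C so_alg"
  shows "(\<lambda>x. B (a x) (b x)) \<in> C"
proof -
  obtain B' where B': "bounded_bilinear B'" "\<And>x y. x \<in> so_alg \<Longrightarrow> y \<in> so_alg \<Longrightarrow> B' x y = B x y"
    by (rule bilinear_extension) blast
  have "(\<lambda>x. B' (a x) (b x)) \<in> smooth_maps C UNIV"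
    using a b smooth_maps_iff by (intro smooth_maps_bilinear[OF B'(1)]) blast+
  then show ?thesis by (simp add: B'(2) smooth_map_mem[OF a] smooth_map_mem[OF b])
qed

lemma form_derivation:
  assumes X: "X \<in> vector_fields C" and a: "a \<in> smooth_maps C so_alg" and b: "b \<in> smooth_maps C so_alg"
  shows "X (\<lambda>x. B (a x) (b x)) = (\<lambda>x. B (deriv_along X a x) (b x) + B (a x) (deriv_along X b x))"
proof -
  obtain B' where B': "bounded_bilinear B'" "\<And>x y. x \<in> so_alg \<Longrightarrow> y \<in> so_alg \<Longrightarrow> B' x y = B x y"
    by (rule bilinear_extension) blast
  have "a \<in> smooth_maps C UNIV" "b \<in> smooth_maps C UNIV" using a b smooth_maps_iff by blast+
  from deriv_along_bilinear[OF B'(1) X this] show ?thesis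
    by (simp add: deriv_along_real B'(2) smooth_map_mem[OF a] smooth_map_mem[OF b]
        deriv_along_so_alg[OF X a] deriv_along_so_alg[OF X b])
qed

end

section \<open>The Maurer--Cartan form of a map to the spin group\<close>

locale spin_map = function_algebra C for C :: "('u \<Rightarrow> real) set" +
  fixes g :: "'u \<Rightarrow> 'n::{finite,linorder} cl"
  assumes g_smooth: "g \<in> smooth_maps C spin_group"
begin

abbreviation \<mu> :: "('u, 'n cl) form1" where "\<mu> \<equiv> pullback1 C g maurer_cartan"

lemma g_mem [simp]: "g x \<in> spin_group"
  using g_smooth by (rule smooth_map_mem)

lemmas g_conj [simp] = spin_group_conj[OF g_mem]

lemma g_conj_cancel [simp]: "cl_conj (g x) \<odot> (g x \<odot> y) = y" "g x \<odot> (cl_conj (g x) \<odot> y) = y"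
  by (simp_all flip: cl_mult_assoc)

lemma g_smooth_UNIV [simp]: "g \<in> smooth_maps C UNIV"
  using g_smooth by (rule smooth_maps_UNIV)

lemma conj_smooth [simp]: "(\<lambda>x. cl_conj (g x)) \<in> smooth_maps C UNIV"
proof (rule smooth_mapI)
  fix b :: "'n cl" assume "b \<in> Basis"
  then obtain S where "b = axis S 1" by (auto simp: Basis_vec_def)
  then show "(\<lambda>x. cl_conj (g x) \<bullet> b) \<in> C"
    using smooth_map_comp[OF g_smooth_UNIV, of "axis S 1"] by (simp add: inner_axis cl_conj_def)
qed simp

text \<open>Differentiate \<open>g\<close> times its inverse = 1 and multiply by the inverse from
  the left.\<close>

lemma deriv_along_conj:
  assumes X: "X \<in> vector_fields C"
  shows "deriv_along X (\<lambda>x. cl_conj (g x)) x = - (cl_conj (g x) \<odot> (deriv_along X g x \<odot> cl_conj (g x)))"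
proof -
  have "deriv_along X (\<lambda>x. g x \<odot> cl_conj (g x)) x = 0"
    by (simp add: deriv_along_const[OF X])
  then have "deriv_along X g x \<odot> cl_conj (g x) + g x \<odot> deriv_along X (\<lambda>x. cl_conj (g x)) x = 0"
    by (simp only: deriv_along_bilinear[OF cl_mult_bilinear X g_smooth_UNIV conj_smooth])
  then have "cl_conj (g x) \<odot> (deriv_along X g x \<odot> cl_conj (g x) + g x \<odot> deriv_along X (\<lambda>x. cl_conj (g x)) x) = 0"
    by (simp add: cl.zero_right)
  then show ?thesis
    by (simp add: cl.add_right eq_neg_iff_add_eq_0 add.commute)
qed

lemma maurer_cartan_eq:
  "X \<in> vector_fields C \<Longrightarrow> \<mu> X = (\<lambda>x. deriv_along X g x \<odot> cl_conj (g x))"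
  by (simp add: pullback1_def maurer_cartan_def cl_inverse_spin_group)

lemma Ad_map_eq: "Ad_map g a = (\<lambda>x. g x \<odot> a x \<odot> cl_conj (g x))"
  by (simp add: Ad_map_def Ad_spin_group)

lemma Ad_map_smooth:
  assumes "a \<in> smooth_maps C so_alg"
  shows "Ad_map g a \<in> smooth_maps C so_alg"
proof (subst smooth_maps_iff, intro conjI allI)
  show "Ad_map g a \<in> smooth_maps C UNIV"
    using smooth_maps_UNIV[OF assms] by (simp add: Ad_map_eq)
  show "Ad_map g a x \<in> so_alg" for x
    by (simp add: Ad_map_def smooth_map_mem[OF assms])
qed

text \<open>Writing dg = \<mu> g in the product rule, the derivatives of \<open>g\<close> and of its
  inverse combine to the commutator with \<mu>.\<close>

lemma deriv_along_Ad_map: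
  assumes X: "X \<in> vector_fields C" and a: "a \<in> smooth_maps C UNIV"
  shows "deriv_along X (Ad_map g a) x
    = Ad (g x) (deriv_along X a x) + commutator (\<mu> X x) (Ad (g x) (a x))"
proof -
  have "deriv_along X (Ad_map g a) x
      = (deriv_along X g x \<odot> a x + g x \<odot> deriv_along X a x) \<odot> cl_conj (g x)
        + g x \<odot> a x \<odot> deriv_along X (\<lambda>x. cl_conj (g x)) x"
    by (simp add: Ad_map_eq deriv_along_bilinear[OF cl_mult_bilinear X] a)
  then show ?thesis
    by (simp add: deriv_along_conj[OF X] maurer_cartan_eq[OF X] Ad_spin_group commutator_def
        cl.add_left cl.minus_right cl_mult_assoc)
qed

text \<open>Here \<mu> is dg times the inverse of g, and its derivative along X on Y is X(Y g) times
  that inverse minus \<mu>(Y) \<mu>(X). Antisymmetrised, the second derivatives become the bracket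
  term of d. The value is half of [\<mu>, \<mu>] because \<open>wedge11 commutator\<close> counts
  each commutator twice.\<close>

lemma maurer_cartan_equation:
  assumes X: "X \<in> vector_fields C" and Y: "Y \<in> vector_fields C"
  shows "d1 C \<mu> X Y x = commutator (\<mu> X x) (\<mu> Y x)"
proof -
  have "deriv_along X (\<mu> Y) x
      = deriv_along X (deriv_along Y g) x \<odot> cl_conj (g x) - \<mu> Y x \<odot> \<mu> X x"
    if X: "X \<in> vector_fields C" and Y: "Y \<in> vector_fields C" for X Y
    by (simp add: maurer_cartan_eq X Y deriv_along_bilinear[OF cl_mult_bilinear X] deriv_along_conj[OF X]
        cl.minus_right cl_mult_assoc)
  then show ?thesis
    by (simp add: d1_eq X Y commutator_def maurer_cartan_eq[OF vf_bracket_mem[OF X Y]]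
        deriv_along_vf_bracket cl.diff_left)
qed

lemma Ad_forms1:
  assumes \<theta>: "\<theta> \<in> forms1 C so_alg"
  shows "Ad_map g \<circ> \<theta> \<in> forms1 C so_alg"
  unfolding forms1_def mem_Collect_eq
proof (intro conjI ballI allI impI)
  show "(Ad_map g \<circ> \<theta>) X \<in> smooth_maps C so_alg" if "X \<in> vector_fields C" for X
    using Ad_map_smooth[OF forms1_smooth[OF \<theta> that]] by simp
qed (simp_all add: forms1_outside[OF \<theta>] forms1_plus[OF \<theta>] forms1_scale[OF \<theta>] fun_eq_iff Ad_map_def
    linear_0[OF linear_Ad] linear_add[OF linear_Ad] linear_cmul[OF linear_Ad])

end

section \<open>The Chern-Simons form under a gauge transformation\<close>

locale spin_gauge = function_algebra_form C B + spin_map C g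
  for C :: "('u \<Rightarrow> real) set" and B :: "'n::{finite,linorder} cl \<Rightarrow> 'n cl \<Rightarrow> real"
    and g :: "'u \<Rightarrow> 'n cl"
begin

lemma wedge_forms2:
  assumes \<theta>: "\<theta> \<in> forms1 C so_alg" and \<eta>: "\<eta> \<in> forms1 C so_alg"
  shows "wedge11 B \<theta> \<eta> \<in> forms2 C UNIV"
proof -
  note mem = forms1_mem[OF \<theta> subspace_so_alg] forms1_mem[OF \<eta> subspace_so_alg]
  note simps = wedge11_def alt11_def form_simps mem fun_eq_iff
  have "wedge11 B \<theta> \<eta> X \<in> forms1 C UNIV" if X: "X \<in> vector_fields C" for X
    unfolding forms1_def mem_Collect_eq
  proof (intro conjI ballI allI impI)
    show "wedge11 B \<theta> \<eta> X Y \<in> smooth_maps C UNIV" if "Y \<in> vector_fields C" for Y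
      using X that by (simp add: wedge11_def alt11_def form_smooth forms1_smooth[OF \<theta>] forms1_smooth[OF \<eta>])
    show "wedge11 B \<theta> \<eta> X Y = 0" if "Y \<notin> vector_fields C" for Y
      using that by (simp add: simps forms1_outside[OF \<theta>] forms1_outside[OF \<eta>])
    show "wedge11 B \<theta> \<eta> X (Y + Z) = wedge11 B \<theta> \<eta> X Y + wedge11 B \<theta> \<eta> X Z"
      if "Y \<in> vector_fields C" "Z \<in> vector_fields C" for Y Z
      using that by (simp add: simps forms1_plus[OF \<theta>] forms1_plus[OF \<eta>])
    show "wedge11 B \<theta> \<eta> X (\<lambda>f. h * Y f) = (\<lambda>x. h x *\<^sub>R wedge11 B \<theta> \<eta> X Y x)"
      if "h \<in> C" "Y \<in> vector_fields C" for h Y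
      using that by (simp add: simps forms1_scale[OF \<theta>] forms1_scale[OF \<eta>] algebra_simps)
  qed
  moreover have "wedge11 B \<theta> \<eta> X = 0" if "X \<notin> vector_fields C" for X
    using that by (simp add: simps forms1_outside[OF \<theta>] forms1_outside[OF \<eta>])
  moreover have "wedge11 B \<theta> \<eta> X Y = - wedge11 B \<theta> \<eta> Y X" for X Y
    by (simp add: wedge11_def alt11_def fun_eq_iff)
  ultimately show ?thesis unfolding forms2_def by blast
qed

lemma d1_mem:
  assumes \<theta>: "\<theta> \<in> forms1 C so_alg" and X: "X \<in> vector_fields C" and Y: "Y \<in> vector_fields C"
  shows "d1 C \<theta> X Y x \<in> so_alg"
  using X Y by (simp add: d1_eq deriv_along_so_alg forms1_smooth[OF \<theta>] smooth_map_mem[OF forms1_smooth[OF \<theta>]])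

text \<open>The graded Leibniz rule. In the first term the 1-form is moved to the front, as
  \<open>wedge12\<close> requires; this costs no sign since the other factor is a 2-form and
  \<open>B\<close> is symmetric.\<close>

lemma d2_wedge:
  assumes \<theta>: "\<theta> \<in> forms1 C so_alg" and \<eta>: "\<eta> \<in> forms1 C so_alg"
    and X: "X \<in> vector_fields C" and Y: "Y \<in> vector_fields C" and Z: "Z \<in> vector_fields C"
  shows "d2 C (wedge11 B \<theta> \<eta>) X Y Z x
    = wedge12 B \<eta> (d1 C \<theta>) X Y Z x - wedge12 B \<theta> (d1 C \<eta>) X Y Z x"
proof -
  note s = forms1_smooth[OF \<theta>] forms1_smooth[OF \<eta>]
  note m = smooth_map_mem[OF forms1_smooth[OF \<theta>]] smooth_map_mem[OF forms1_smooth[OF \<eta>]]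
  have W: "deriv_along V (wedge11 B \<theta> \<eta> U U') x =
      B (deriv_along V (\<theta> U) x) (\<eta> U' x) + B (\<theta> U x) (deriv_along V (\<eta> U') x)
      - B (deriv_along V (\<theta> U') x) (\<eta> U x) - B (\<theta> U' x) (deriv_along V (\<eta> U) x)"
    if V: "V \<in> vector_fields C" and U: "U \<in> vector_fields C" "U' \<in> vector_fields C" for U U' V
    by (simp add: deriv_along_real wedge11_def alt11_def vf_diff[OF V] form_smooth s U form_derivation[OF V])
  have sym: "B (\<eta> U x) z = B z (\<eta> U x)" if "U \<in> vector_fields C" "z \<in> so_alg" for U z
    using that by (simp add: form_sym m)
  show ?thesis
    by (simp add: d2_def X Y Z W)
      (simp add: wedge12_def alt12_def wedge11_def alt11_def sym X Y Z d1_eq form_simps m s deriv_along_so_alg)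
qed

text \<open>Three equal cyclic terms, each doubled by \<open>wedge11\<close>, give 6. Hence the
  cubic term of \<open>cs3\<close> enters with coefficient 2 and that of \<open>cartan3\<close> with
  coefficient 1.\<close>

lemma wedge12_commutator:
  assumes "\<And>X. \<theta> X x \<in> so_alg"
  shows "wedge12 B \<theta> (wedge11 commutator \<theta> \<theta>) X Y Z x = 6 * B (\<theta> X x) (commutator (\<theta> Y x) (\<theta> Z x))"
  using form_permute[of "\<theta> X x" "\<theta> Y x" "\<theta> Z x"]
  by (simp add: wedge12_def alt12_def wedge11_def alt11_def form_simps assms)

lemma pullback_cartan3:
  assumes \<mu>: "\<And>X. \<mu> X x \<in> so_alg"
    and X: "X \<in> vector_fields C" and Y: "Y \<in> vector_fields C" and Z: "Z \<in> vector_fields C"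
  shows "pullback3 C g (cartan3 B) X Y Z x = B (\<mu> X x) (commutator (\<mu> Y x) (\<mu> Z x))"
proof -
  have "pullback3 C g (cartan3 B) X Y Z x = 1/6 * wedge12 B \<mu> (wedge11 commutator \<mu> \<mu>) X Y Z x"
    by (simp add: pullback3_def cartan3_def pullback1_def wedge12_def wedge11_def alt12_def alt11_def X Y Z)
  then show ?thesis by (simp add: wedge12_commutator \<mu>)
qed

lemma gauge_maurer_cartan_form:
  assumes \<theta>0: "\<theta>0 \<in> forms1 C so_alg" and \<theta>1: "\<theta>1 \<in> forms1 C so_alg"
    and gauge: "\<theta>0 - (Ad_map g \<circ> \<theta>1) = - \<mu>"
  shows "\<mu> \<in> forms1 C so_alg"
proof -
  have "\<mu> = (Ad_map g \<circ> \<theta>1) - \<theta>0"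
    using arg_cong[OF gauge, of uminus] by simp
  then show ?thesis
    using forms1_diff[OF subspace_so_alg Ad_forms1[OF \<theta>1] \<theta>0] by simp
qed

text \<open>Invariance of \<open>B\<close> under Ad replaces \<theta>1 by \<theta>0 + \<mu> and
  d\<theta>1 by its image under Ad, which is computed below in terms of \<theta>0 and \<mu>. The
  claim is then the pointwise identity \<open>chern_simons_gauge_algebra\<close>.\<close>

lemma chern_simons_gauge:
  assumes \<theta>0: "\<theta>0 \<in> forms1 C so_alg" and \<theta>1: "\<theta>1 \<in> forms1 C so_alg"
    and gauge: "\<theta>0 - (Ad_map g \<circ> \<theta>1) = - \<mu>"
    and X: "X \<in> vector_fields C" and Y: "Y \<in> vector_fields C" and Z: "Z \<in> vector_fields C"
  shows "cs3 C B \<theta>1 X Y Z x - cs3 C B \<theta>0 X Y Z x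
    = - d2 C (wedge11 B \<mu> \<theta>0) X Y Z x - pullback3 C g (cartan3 B) X Y Z x"
proof -
  have \<mu>: "\<mu> \<in> forms1 C so_alg" by (rule gauge_maurer_cartan_form[OF \<theta>0 \<theta>1 gauge])
  note mem = forms1_mem[OF \<theta>0 subspace_so_alg] forms1_mem[OF \<theta>1 subspace_so_alg]
    forms1_mem[OF \<mu> subspace_so_alg]
  have gauge': "Ad_map g (\<theta>1 V) = (\<lambda>x. \<theta>0 V x + \<mu> V x)" for V
  proof
    fix x
    have "(\<theta>0 - (Ad_map g \<circ> \<theta>1)) V x = (- \<mu>) V x" by (simp only: gauge)
    then show "Ad_map g (\<theta>1 V) x = \<theta>0 V x + \<mu> V x" by (simp add: algebra_simps)
  qed
  have Ad\<theta>: "Ad (g x) (\<theta>1 V x) = \<theta>0 V x + \<mu> V x" for V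
    using fun_cong[OF gauge', of V x] by (simp add: Ad_map_def)
  \<comment> \<open>Differentiate Ad \<theta>1 = \<theta>0 + \<mu> and solve for the term in which
    Ad itself is not differentiated.\<close>
  have deriv: "Ad (g x) (deriv_along V (\<theta>1 W) x)
      = deriv_along V (\<theta>0 W) x + deriv_along V (\<mu> W) x - commutator (\<mu> V x) (\<theta>0 W x + \<mu> W x)"
    if V: "V \<in> vector_fields C" and W: "W \<in> vector_fields C" for V W
  proof -
    have "deriv_along V (Ad_map g (\<theta>1 W)) x = deriv_along V (\<theta>0 W) x + deriv_along V (\<mu> W) x"
      unfolding gauge'
      by (simp add: deriv_along_add[OF V] smooth_maps_UNIV[OF forms1_smooth[OF \<theta>0 W]]
          smooth_maps_UNIV[OF forms1_smooth[OF \<mu> W]])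
    then show ?thesis
      by (simp add: deriv_along_Ad_map[OF V smooth_maps_UNIV[OF forms1_smooth[OF \<theta>1 W]]] Ad\<theta> eq_diff_eq)
  qed
  have dAd: "Ad (g x) (d1 C \<theta>1 V W x) = d1 C \<theta>0 V W x + commutator (\<mu> V x) (\<mu> W x)
      - commutator (\<mu> V x) (\<theta>0 W x + \<mu> W x) + commutator (\<mu> W x) (\<theta>0 V x + \<mu> V x)"
    if V: "V \<in> vector_fields C" and W: "W \<in> vector_fields C" for V W
  proof -
    have "Ad (g x) (d1 C \<theta>1 V W x) = d1 C \<theta>0 V W x + d1 C \<mu> V W x
      - commutator (\<mu> V x) (\<theta>0 W x + \<mu> W x) + commutator (\<mu> W x) (\<theta>0 V x + \<mu> V x)"
      by (simp add: d1_eq V W linear_diff[OF linear_Ad] deriv Ad\<theta>)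
    then show ?thesis by (simp add: maurer_cartan_equation V W)
  qed
  have form1: "B (\<theta>1 U x) (d1 C \<theta>1 V W x) = B (\<theta>0 U x + \<mu> U x) (d1 C \<theta>0 V W x
      + commutator (\<mu> V x) (\<mu> W x) - commutator (\<mu> V x) (\<theta>0 W x + \<mu> W x)
      + commutator (\<mu> W x) (\<theta>0 V x + \<mu> V x))"
    if V: "V \<in> vector_fields C" and W: "W \<in> vector_fields C" for U V W
    by (simp add: form_Ad[OF g_mem mem(2) d1_mem[OF \<theta>1 V W], of x, symmetric] Ad\<theta> dAd[OF V W])
  have form2: "B (\<theta>1 X x) (commutator (\<theta>1 Y x) (\<theta>1 Z x))
      = B (\<theta>0 X x + \<mu> X x) (commutator (\<theta>0 Y x + \<mu> Y x) (\<theta>0 Z x + \<mu> Z x))"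
    by (simp add: form_Ad[OF g_mem, of "\<theta>1 X x" "commutator (\<theta>1 Y x) (\<theta>1 Z x)" x, symmetric] mem
        Ad_commutator Ad\<theta>)
  have MC: "wedge12 B \<theta>0 (d1 C \<mu>) X Y Z x = B (\<theta>0 X x) (commutator (\<mu> Y x) (\<mu> Z x))
      - B (\<theta>0 Y x) (commutator (\<mu> X x) (\<mu> Z x)) + B (\<theta>0 Z x) (commutator (\<mu> X x) (\<mu> Y x))"
    by (simp add: wedge12_def alt12_def maurer_cartan_equation X Y Z)
  show ?thesis
    unfolding d2_wedge[OF \<mu> \<theta>0 X Y Z] MC pullback_cartan3[OF mem(3) X Y Z] cs3_def
      wedge12_commutator[of \<theta>0, OF mem(1)] wedge12_commutator[of \<theta>1, OF mem(2)] form2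
    using chern_simons_gauge_algebra[of "\<mu> X x" "\<mu> Y x" "\<mu> Z x" "\<theta>0 X x" "\<theta>0 Y x" "\<theta>0 Z x"
        "d1 C \<theta>0 Y Z x" "d1 C \<theta>0 X Z x" "d1 C \<theta>0 X Y x"]
    by (simp add: mem d1_mem[OF \<theta>0] X Y Z wedge12_def alt12_def form1)
qed

lemma form_star_form1:
  assumes \<mu>: "\<mu> \<in> forms1 C so_alg" and a: "a \<in> smooth_maps C so_alg"
  shows "form_star B \<mu> a \<in> forms1 C UNIV"
  unfolding forms1_def mem_Collect_eq
proof (intro conjI ballI allI impI)
  show "form_star B \<mu> a X \<in> smooth_maps C UNIV" if "X \<in> vector_fields C" for X
    by (simp add: form_star_def form_smooth a forms1_smooth[OF \<mu> that])
qed (simp_all add: form_star_def fun_eq_iff form_simps smooth_map_mem[OF a] forms1_mem[OF \<mu> subspace_so_alg]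
    forms1_outside[OF \<mu>] forms1_plus[OF \<mu>] forms1_scale[OF \<mu>])

subsection \<open>Inner matrices are automorphisms\<close>

context
  fixes \<omega> :: "('u, real) form2"
  assumes \<mu>: "\<mu> \<in> forms1 C so_alg" and \<omega>: "\<omega> \<in> forms2 C UNIV"
    and closed: "d2 C \<omega> + pullback3 C g (cartan3 B) = 0"
begin

lemma mu_mem [simp]: "\<mu> X x \<in> so_alg"
  by (rule forms1_mem[OF \<mu> subspace_so_alg])

lemma mu_smooth: "X \<in> vector_fields C \<Longrightarrow> \<mu> X \<in> smooth_maps C so_alg"
  by (rule forms1_smooth[OF \<mu>])

definition lower_row :: "'u vfield \<Rightarrow> ('u \<Rightarrow> 'n cl) \<Rightarrow> ('u, real) form1" where
  "lower_row X a = \<omega> X - form_star B \<mu> (\<mu> X) + 2 * form_star B \<mu> (Ad_map g a)"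

lemma inner_matrix_apply:
  "inner_matrix C B g \<omega> (X, a, \<xi>) = (X, Ad_map g a - \<mu> X, lower_row X a + \<xi>)"
  by (simp add: inner_matrix_def block_matrix_def lower_row_def)

lemma lower_row_apply:
  "lower_row X a Z x = \<omega> X Z x - B (\<mu> X x) (\<mu> Z x) + 2 * B (Ad (g x) (a x)) (\<mu> Z x)"
  by (simp add: lower_row_def form_star_def Ad_map_def)

lemma lower_row_form1:
  assumes X: "X \<in> vector_fields C" and a: "a \<in> smooth_maps C so_alg"
  shows "lower_row X a \<in> forms1 C UNIV"
  unfolding lower_row_def mult_2
  by (intro forms1_add forms1_diff subspace_UNIV form_star_form1[OF \<mu>] forms2_form1[OF \<omega> X]
      mu_smooth[OF X] Ad_map_smooth[OF a])

lemma inner_matrix_bij: "bij_betw (inner_matrix C B g \<omega>) (ca_sections C) (ca_sections C)"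
proof -
  \<comment> \<open>The pointwise inverse of \<open>Ad_map g\<close>.\<close>
  define Ai where "Ai b = (\<lambda>x. cl_conj (g x) \<odot> b x \<odot> g x)" for b
  have Ai: "Ad_map g (Ai b) = b" "Ai (Ad_map g b) = b" for b
    by (simp_all add: Ai_def Ad_map_eq cl_mult_assoc)
  have Ai_smooth: "Ai b \<in> smooth_maps C so_alg" if "b \<in> smooth_maps C so_alg" for b
    using smooth_maps_UNIV[OF that] smooth_map_mem[OF that]
    by (subst smooth_maps_iff) (simp add: Ai_def conj_so_alg)
  \<comment> \<open>The block triangular system solved from top to bottom: b = Ad a - \<mu> X
    determines a, and then the form component follows.\<close>
  define inv where "inv = (\<lambda>(X, b, \<eta>). (X, Ai (b + \<mu> X), \<eta> - lower_row X (Ai (b + \<mu> X))))"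
  show ?thesis
  proof (rule bij_betwI[where g = inv])
    show "inner_matrix C B g \<omega> \<in> ca_sections C \<rightarrow> ca_sections C"
    proof (clarsimp simp: ca_sections_def inner_matrix_apply)
      fix X and a :: "'u \<Rightarrow> 'n cl" and \<xi> :: "('u, real) form1"
      assume X: "X \<in> vector_fields C" and a: "a \<in> smooth_maps C so_alg" and \<xi>: "\<xi> \<in> forms1 C UNIV"
      show "Ad_map g a - \<mu> X \<in> smooth_maps C so_alg \<and> lower_row X a + \<xi> \<in> forms1 C UNIV"
        using smooth_maps_subspace_diff[OF subspace_so_alg Ad_map_smooth[OF a] mu_smooth[OF X]]
          forms1_add[OF subspace_UNIV lower_row_form1[OF X a] \<xi>]
        by (simp add: fun_diff_def)
    qed
    show "inv \<in> ca_sections C \<rightarrow> ca_sections C"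
    proof (clarsimp simp: ca_sections_def inv_def)
      fix X and b :: "'u \<Rightarrow> 'n cl" and \<eta> :: "('u, real) form1"
      assume X: "X \<in> vector_fields C" and b: "b \<in> smooth_maps C so_alg" and \<eta>: "\<eta> \<in> forms1 C UNIV"
      have a: "Ai (b + \<mu> X) \<in> smooth_maps C so_alg"
        using Ai_smooth[OF smooth_maps_subspace_add[OF subspace_so_alg b mu_smooth[OF X]]]
        by (simp add: plus_fun_def)
      then show "Ai (b + \<mu> X) \<in> smooth_maps C so_alg
          \<and> \<eta> - lower_row X (Ai (b + \<mu> X)) \<in> forms1 C UNIV"
        using forms1_diff[OF subspace_UNIV \<eta> lower_row_form1[OF X a]] by simp
    qed
    show "inv (inner_matrix C B g \<omega> e) = e" for e
      by (cases e) (simp add: inv_def inner_matrix_apply Ai)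
    show "inner_matrix C B g \<omega> (inv e) = e" for e
      by (cases e) (simp add: inv_def inner_matrix_apply Ai)
  qed
qed

lemma bracket_form:
  assumes X: "X \<in> vector_fields C" and Y: "Y \<in> vector_fields C" and Z: "Z \<in> vector_fields C"
  shows "(lie_derivative C X \<eta> - d1 C \<xi> Y + ca_P C B a b) Z x
    = X (\<eta> Z) x - \<eta> (vf_bracket X Z) x - (Y (\<xi> Z) x - Z (\<xi> Y) x - \<xi> (vf_bracket Y Z) x)
      + 2 * B (b x) (deriv_along Z a x)"
  by (simp add: lie_derivative_def ca_P_def d1_eq[OF Y Z] deriv_along_real Z)

text \<open>The components are compared separately. The Lie algebra component uses the Maurer-Cartan
  equation; the form component, evaluated on a vector field Z, also uses invariance under Ad and the
  closedness condition.\<close>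

lemma inner_matrix_bracket:
  assumes X: "X \<in> vector_fields C" and a: "a \<in> smooth_maps C so_alg" and \<xi>: "\<xi> \<in> forms1 C UNIV"
    and Y: "Y \<in> vector_fields C" and b: "b \<in> smooth_maps C so_alg" and \<eta>: "\<eta> \<in> forms1 C UNIV"
  shows "inner_matrix C B g \<omega> (ca_bracket C B (X, a, \<xi>) (Y, b, \<eta>))
    = ca_bracket C B (inner_matrix C B g \<omega> (X, a, \<xi>)) (inner_matrix C B g \<omega> (Y, b, \<eta>))"
proof -
  have mem: "a x \<in> so_alg" "b x \<in> so_alg" for x
    using a b by (simp_all add: smooth_map_mem)
  have Ad_smooth: "Ad_map g a \<in> smooth_maps C so_alg" "Ad_map g b \<in> smooth_maps C so_alg"
    using a b by (simp_all add: Ad_map_smooth)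
  have Ad_apply: "Ad_map g c x = Ad (g x) (c x)" for c x
    by (simp add: Ad_map_def)
  have dAd: "deriv_along V (\<lambda>x. Ad_map g c x - \<mu> W x) x = Ad (g x) (deriv_along V c x)
      + commutator (\<mu> V x) (Ad (g x) (c x)) - deriv_along V (\<mu> W) x"
    if V: "V \<in> vector_fields C" and W: "W \<in> vector_fields C" and c: "c \<in> smooth_maps C so_alg" for V W c x
    by (simp add: deriv_along_diff[OF V smooth_maps_UNIV[OF Ad_map_smooth[OF c]]
          smooth_maps_UNIV[OF mu_smooth[OF W]]] deriv_along_Ad_map[OF V smooth_maps_UNIV[OF c]])
  have mu_bracket: "\<mu> (vf_bracket V W) x = deriv_along V (\<mu> W) x - deriv_along W (\<mu> V) x
      - commutator (\<mu> V x) (\<mu> W x)" if V: "V \<in> vector_fields C" and W: "W \<in> vector_fields C" for V W x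
    using maurer_cartan_equation[OF V W, of x] by (simp add: d1_eq[OF V W] algebra_simps)
  define c where "c = deriv_along X b - deriv_along Y a + (\<lambda>x. commutator (a x) (b x))"
  have Ad_c: "Ad (g x) (c x) = Ad (g x) (deriv_along X b x) - Ad (g x) (deriv_along Y a x)
      + commutator (Ad (g x) (a x)) (Ad (g x) (b x))" for x
    by (simp add: c_def linear_add[OF linear_Ad] linear_diff[OF linear_Ad] Ad_commutator)
  \<comment> \<open>The terms from differentiating Ad cancel the mixed terms of the commutator; the
    terms in \<mu> alone agree by the Maurer-Cartan equation.\<close>
  have "Ad_map g c - \<mu> (vf_bracket X Y)
      = deriv_along X (Ad_map g b - \<mu> Y) - deriv_along Y (Ad_map g a - \<mu> X)
        + (\<lambda>x. commutator ((Ad_map g a - \<mu> X) x) ((Ad_map g b - \<mu> Y) x))"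
  proof
    fix x
    show "(Ad_map g c - \<mu> (vf_bracket X Y)) x
      = (deriv_along X (Ad_map g b - \<mu> Y) - deriv_along Y (Ad_map g a - \<mu> X)
        + (\<lambda>x. commutator ((Ad_map g a - \<mu> X) x) ((Ad_map g b - \<mu> Y) x))) x"
      using commutator_flip[of "\<mu> Y x" "Ad (g x) (a x)"]
      by (simp add: fun_diff_def dAd[OF X Y b] dAd[OF Y X a] mu_bracket[OF X Y])
        (simp add: Ad_apply Ad_c comm.diff_left comm.diff_right)
  qed
  moreover have "lower_row (vf_bracket X Y) c + (lie_derivative C X \<eta> - d1 C \<xi> Y + ca_P C B a b)
      = lie_derivative C X (lower_row Y b + \<eta>) - d1 C (lower_row X a + \<xi>) Y
        + ca_P C B (Ad_map g a - \<mu> X) (Ad_map g b - \<mu> Y)"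
  proof (intro ext)
    fix Z x
    show "(lower_row (vf_bracket X Y) c + (lie_derivative C X \<eta> - d1 C \<xi> Y + ca_P C B a b)) Z x
      = (lie_derivative C X (lower_row Y b + \<eta>) - d1 C (lower_row X a + \<xi>) Y
        + ca_P C B (Ad_map g a - \<mu> X) (Ad_map g b - \<mu> Y)) Z x"
    proof (cases "Z \<in> vector_fields C")
      case False
      have "\<omega> (vf_bracket X Y) Z = 0" "\<mu> Z = 0"
        using False forms1_outside[OF forms2_form1[OF \<omega> vf_bracket_mem[OF X Y]]] forms1_outside[OF \<mu>]
        by auto
      moreover have "Ad (g x) (c x) \<in> so_alg"
        by (simp add: c_def mem deriv_along_so_alg X Y a b)
      ultimately show ?thesis
        using False by (simp add: lower_row_apply lie_derivative_def d1_def ca_P_def form_simps)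
    next
      case Z: True
      \<comment> \<open>The derivative of the form component of an image. It is stated for general
        sections because it is used for two terms of the Lie derivative and d1 on the first section
        and one on the second.\<close>
      have D: "V ((lower_row W a + \<xi>) U) x = V (\<omega> W U) x - B (deriv_along V (\<mu> W) x) (\<mu> U x)
          - B (\<mu> W x) (deriv_along V (\<mu> U) x)
          + 2 * B (Ad (g x) (deriv_along V a x) + commutator (\<mu> V x) (Ad (g x) (a x))) (\<mu> U x)
          + 2 * B (Ad (g x) (a x)) (deriv_along V (\<mu> U) x) + V (\<xi> U) x"
        if V: "V \<in> vector_fields C" and U: "U \<in> vector_fields C" and W: "W \<in> vector_fields C"
          and a: "a \<in> smooth_maps C so_alg" and \<xi>: "\<xi> \<in> forms1 C UNIV" for V U W a \<xi>
      proof -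
        have eq: "(lower_row W a + \<xi>) U = (\<lambda>x. \<omega> W U x - B (\<mu> W x) (\<mu> U x)
            + (2 * B (Ad_map g a x) (\<mu> U x)) + \<xi> U x)"
          by (simp add: fun_eq_iff lower_row_apply Ad_map_def)
        have mem: "\<omega> W U \<in> C" "\<xi> U \<in> C" "(\<lambda>x. B (\<mu> W x) (\<mu> U x)) \<in> C"
          "(\<lambda>x. B (Ad_map g a x) (\<mu> U x)) \<in> C"
          using forms2_smooth[OF \<omega> W U] forms1_smooth[OF \<xi> U]
            form_smooth[OF mu_smooth[OF W] mu_smooth[OF U]]
            form_smooth[OF Ad_map_smooth[OF a] mu_smooth[OF U]] by simp_all
        show ?thesis
          unfolding eq
          by (simp add: vf_add[OF V] vf_diff[OF V] vf_scale[OF V] mem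
              form_derivation[OF V mu_smooth[OF W] mu_smooth[OF U]]
              form_derivation[OF V Ad_map_smooth[OF a] mu_smooth[OF U]]
              deriv_along_Ad_map[OF V smooth_maps_UNIV[OF a]])
            (simp add: Ad_apply)
      qed
      \<comment> \<open>Closedness on X, Y, Z, with two terms flipped so that the bracket stands in
        the second slot, where the Lie derivative and d1 put it.\<close>
      have d\<omega>: "X (\<omega> Y Z) x - Y (\<omega> X Z) x + Z (\<omega> X Y) x - \<omega> (vf_bracket X Y) Z x
          - \<omega> Y (vf_bracket X Z) x + \<omega> X (vf_bracket Y Z) x = - B (\<mu> X x) (commutator (\<mu> Y x) (\<mu> Z x))"
      proof -
        have "(d2 C \<omega> + pullback3 C g (cartan3 B)) X Y Z x = 0" by (simp add: closed)
        then have "d2 C \<omega> X Y Z x = - B (\<mu> X x) (commutator (\<mu> Y x) (\<mu> Z x))"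
          by (simp add: pullback_cartan3 X Y Z)
        then show ?thesis
          using forms2_flip[OF \<omega>, of "vf_bracket X Z" Y] forms2_flip[OF \<omega>, of "vf_bracket Y Z" X]
          by (simp add: d2_def X Y Z deriv_along_real)
      qed
      note so = mem deriv_along_so_alg[OF X b] deriv_along_so_alg[OF Y a] deriv_along_so_alg[OF Z a]
        deriv_along_so_alg[OF X mu_smooth[OF Y]] deriv_along_so_alg[OF X mu_smooth[OF Z]]
        deriv_along_so_alg[OF Y mu_smooth[OF X]] deriv_along_so_alg[OF Y mu_smooth[OF Z]]
        deriv_along_so_alg[OF Z mu_smooth[OF X]] deriv_along_so_alg[OF Z mu_smooth[OF Y]]
      \<comment> \<open>The term of the original bracket coming from \<open>ca_P\<close> lacks Ad;
        invariance brings it to the shape of the others.\<close>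
      have Ad_form: "B (b x) (deriv_along Z a x) = B (Ad (g x) (b x)) (Ad (g x) (deriv_along Z a x))"
        by (simp add: form_Ad so)
      \<comment> \<open>Reference orders for the cubic terms: Ad a may replace \<mu> X, and Ad b may
        replace \<mu> Y.\<close>
      note T = form_permute[of "\<mu> X x" "\<mu> Y x" "\<mu> Z x"]
        form_permute[of "Ad (g x) (a x)" "\<mu> Y x" "\<mu> Z x"]
        form_permute[of "\<mu> X x" "Ad (g x) (b x)" "\<mu> Z x"]
        form_permute[of "Ad (g x) (a x)" "Ad (g x) (b x)" "\<mu> Z x"]
      have sym: "B (\<mu> V x) (deriv_along W (\<mu> U) x) = B (deriv_along W (\<mu> U) x) (\<mu> V x)"
        if "W \<in> vector_fields C" "U \<in> vector_fields C" for U V W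
        by (simp add: form_sym deriv_along_so_alg mu_smooth that)
      have sym': "B (\<mu> Y x) (Ad (g x) (deriv_along Z a x)) = B (Ad (g x) (deriv_along Z a x)) (\<mu> Y x)"
        by (simp add: form_sym so)
      \<comment> \<open>Only this sum is split at first: the left side of \<open>D\<close> contains
        the sums \<open>lower_row W a + \<xi>\<close> unsplit, so \<open>plus_fun_apply\<close> has
        to wait.\<close>
      have lhs: "(lower_row (vf_bracket X Y) c + K) Z x = lower_row (vf_bracket X Y) c Z x + K Z x" for K
        by simp
      show ?thesis
        unfolding lhs bracket_form[OF X Y Z]
        unfolding D[OF X Z Y b \<eta>] D[OF Y Z X a \<xi>] D[OF Z Y X a \<xi>]
        unfolding fun_diff_def dAd[OF Z X a]
        unfolding lower_row_apply mu_bracket[OF X Y] mu_bracket[OF X Z] mu_bracket[OF Y Z]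
          plus_fun_apply Ad_c Ad_form Ad_apply
        using d\<omega>
        by (simp add: form_simps so form_invariant) (simp add: T so sym sym' X Y Z algebra_simps)
    qed
  qed
  ultimately show ?thesis
    by (simp add: ca_bracket_def inner_matrix_apply c_def)
qed

lemma inner_matrix_automorphism: "ca_automorphism C B (inner_matrix C B g \<omega>)"
proof -
  have add: "inner_matrix C B g \<omega> ((X, a, \<xi>) + (Y, b, \<eta>))
      = inner_matrix C B g \<omega> (X, a, \<xi>) + inner_matrix C B g \<omega> (Y, b, \<eta>)"
    if X: "X \<in> vector_fields C" and Y: "Y \<in> vector_fields C"
      and a: "a \<in> smooth_maps C so_alg" and b: "b \<in> smooth_maps C so_alg" for X Y a b \<xi> \<eta>
  proof -
    \<comment> \<open>\<open>forms2\<close> gives linearity in the second argument; antisymmetry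
      carries it to the first.\<close>
    have "\<omega> (X + Y) Z x = \<omega> X Z x + \<omega> Y Z x" for Z x
    proof (cases "Z \<in> vector_fields C")
      case True
      then show ?thesis
        using fun_cong[OF forms1_plus[OF forms2_form1[OF \<omega> True] X Y], of x]
          forms2_flip[OF \<omega>, of _ Z] by simp
    next
      case False
      then show ?thesis
        using forms1_outside[OF forms2_form1[OF \<omega>]] X Y by simp
    qed
    then show ?thesis
      by (simp add: inner_matrix_apply fun_eq_iff lower_row_apply Ad_map_def linear_add[OF linear_Ad]
          forms1_plus[OF \<mu> X Y] form_simps smooth_map_mem[OF a] smooth_map_mem[OF b])
  qed
  have scale: "inner_matrix C B g \<omega> (ca_scale h (X, a, \<xi>)) = ca_scale h (inner_matrix C B g \<omega> (X, a, \<xi>))"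
    if h: "h \<in> C" and X: "X \<in> vector_fields C" and a: "a \<in> smooth_maps C so_alg" for h X a \<xi>
  proof -
    have "\<omega> (\<lambda>f. h * X f) Z x = h x * \<omega> X Z x" for Z x
    proof (cases "Z \<in> vector_fields C")
      case True
      then show ?thesis
        using fun_cong[OF forms1_scale[OF forms2_form1[OF \<omega> True] h X], of x]
          forms2_flip[OF \<omega>, of _ Z] by simp
    next
      case False
      have "(\<lambda>f. h * X f) \<in> vector_fields C"
        by (rule vf_scale_mem[OF h X])
      then show ?thesis
        using False forms1_outside[OF forms2_form1[OF \<omega>]] X by simp
    qed
    then show ?thesis
      by (simp add: inner_matrix_apply ca_scale_def fun_eq_iff lower_row_apply Ad_map_def
          linear_cmul[OF linear_Ad] forms1_scale[OF \<mu> h X] form_simps smooth_map_mem[OF a]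
          scaleR_diff_right algebra_simps)
  qed
  have pairing: "ca_pairing B (inner_matrix C B g \<omega> (X, a, \<xi>)) (inner_matrix C B g \<omega> (Y, b, \<eta>))
      = ca_pairing B (X, a, \<xi>) (Y, b, \<eta>)"
    if a: "a \<in> smooth_maps C so_alg" and b: "b \<in> smooth_maps C so_alg" for X Y a b \<xi> \<eta>
  proof
    fix x
    have mem: "a x \<in> so_alg" "b x \<in> so_alg" using a b by (simp_all add: smooth_map_mem)
    \<comment> \<open>In the pairing \<omega> cancels by antisymmetry, while the quadratic block and
      the factor 2 compensate the terms with \<mu> in the product of Ad a - \<mu> X and Ad b - \<mu>
      Y.\<close>
    have "\<omega> Y X x = - \<omega> X Y x"
      using forms2_flip[OF \<omega>, of Y X] by simp
    then show "ca_pairing B (inner_matrix C B g \<omega> (X, a, \<xi>)) (inner_matrix C B g \<omega> (Y, b, \<eta>)) x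
        = ca_pairing B (X, a, \<xi>) (Y, b, \<eta>) x"
      using form_sym[of "\<mu> X x" "\<mu> Y x"] form_sym[of "\<mu> X x" "Ad (g x) (b x)"]
      by (simp add: ca_pairing_def inner_matrix_apply lower_row_apply Ad_map_def form_simps form_Ad mem
          field_simps)
  qed
  have anchor: "ca_anchor (inner_matrix C B g \<omega> e) = ca_anchor e" for e
    by (cases e) (simp add: ca_anchor_def inner_matrix_apply)
  show ?thesis
    unfolding ca_automorphism_def
    by (intro conjI ballI inner_matrix_bij anchor)
      (auto simp: ca_sections_def add scale pairing inner_matrix_bracket simp del: add_Pair)
qed

end

end

section \<open>Smooth functions form an algebra\<close>

lemma C_k_Suc: "C_k m (Suc k) V f \<Longrightarrow> C_k m k V f"
proof (induction k arbitrary: f)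
  case (Suc k)
  then show ?case by (subst C_k.simps, subst (asm) (2) C_k.simps) blast
qed simp

lemma C_k_const: "C_k m k V (\<lambda>x. c)"
proof (induction k arbitrary: c)
  case (Suc k)
  have "((\<lambda>t. c) has_real_derivative 0) (at 0)" by simp
  with Suc show ?case by (auto intro!: exI[of _ "\<lambda>x. 0"])
qed simp

lemma C_k_add: "C_k m k V f \<Longrightarrow> C_k m k V h \<Longrightarrow> C_k m k V (\<lambda>x. f x + h x)"
proof (induction k arbitrary: f h)
  case (Suc k)
  have "\<exists>d. (\<forall>x\<in>V. ((\<lambda>t. f (x(i := x i + t)) + h (x(i := x i + t))) has_real_derivative d x) (at 0)) \<and> C_k m k V d"
    if i: "i < m" for i
  proof -
    obtain f' where f': "\<forall>x\<in>V. ((\<lambda>t. f (x(i := x i + t))) has_real_derivative f' x) (at 0)" "C_k m k V f'"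
      using Suc.prems(1) i by (auto simp del: fun_upd_apply)
    obtain h' where h': "\<forall>x\<in>V. ((\<lambda>t. h (x(i := x i + t))) has_real_derivative h' x) (at 0)" "C_k m k V h'"
      using Suc.prems(2) i by (auto simp del: fun_upd_apply)
    have 1: "((\<lambda>t. f (x(i := x i + t)) + h (x(i := x i + t))) has_real_derivative f' x + h' x) (at 0)"
      if "x \<in> V" for x
      using f'(1) h'(1) that by (intro DERIV_add) blast+
    have 2: "C_k m k V (\<lambda>x. f' x + h' x)"
      by (rule Suc.IH[OF f'(2) h'(2)])
    show ?thesis by (rule exI[of _ "\<lambda>x. f' x + h' x"], intro conjI ballI 1 2)
  qed
  then show ?case
    using Suc.prems by (simp add: continuous_map_add)
qed (simp add: continuous_map_add)

text \<open>The derivative f' h + h' f mixes orders, so \<open>C_k_Suc\<close> first lowers f and h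
  to the order of their derivatives.\<close>

lemma C_k_mult: "C_k m k V f \<Longrightarrow> C_k m k V h \<Longrightarrow> C_k m k V (\<lambda>x. f x * h x)"
proof (induction k arbitrary: f h)
  case (Suc k)
  have "\<exists>d. (\<forall>x\<in>V. ((\<lambda>t. f (x(i := x i + t)) * h (x(i := x i + t))) has_real_derivative d x) (at 0)) \<and> C_k m k V d"
    if i: "i < m" for i
  proof -
    obtain f' where f': "\<forall>x\<in>V. ((\<lambda>t. f (x(i := x i + t))) has_real_derivative f' x) (at 0)" "C_k m k V f'"
      using Suc.prems(1) i by (auto simp del: fun_upd_apply)
    obtain h' where h': "\<forall>x\<in>V. ((\<lambda>t. h (x(i := x i + t))) has_real_derivative h' x) (at 0)" "C_k m k V h'"
      using Suc.prems(2) i by (auto simp del: fun_upd_apply)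
    have 1: "((\<lambda>t. f (x(i := x i + t)) * h (x(i := x i + t))) has_real_derivative f' x * h x + h' x * f x) (at 0)"
      if "x \<in> V" for x
      using DERIV_mult[OF f'(1)[rule_format, OF that] h'(1)[rule_format, OF that]]
      by simp
    have 2: "C_k m k V (\<lambda>x. f' x * h x + h' x * f x)"
      by (intro C_k_add Suc.IH f'(2) h'(2) C_k_Suc[OF Suc.prems(1)] C_k_Suc[OF Suc.prems(2)])
    show ?thesis by (rule exI[of _ "\<lambda>x. f' x * h x + h' x * f x"], intro conjI ballI 1 2)
  qed
  then show ?case
    using Suc.prems by (simp add: continuous_map_real_mult)
qed (simp add: continuous_map_real_mult)

lemma function_algebra_smooth_functions: "function_algebra (smooth_functions m \<A>)"
  by unfold_locales
    (simp_all add: smooth_functions_def smooth_on_def comp_def split_beta C_k_const C_k_add C_k_mult)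

section \<open>The matrix of a gauge datum as an inner automorphism\<close>

theorem corollaryA11:
  fixes m :: nat
    and \<A> :: "('u::{t2_space,second_countable_topology} set \<times> ('u \<Rightarrow> nat \<Rightarrow> real)) set"
    and C :: "('u \<Rightarrow> real) set"
    and B :: "'n::{finite,linorder} cl \<Rightarrow> 'n cl \<Rightarrow> real"
    and g :: "'u \<Rightarrow> 'n cl"
    and A :: "('u, real) form1"
    and \<omega>2 :: "('u, real) form2"
    and \<theta>0 \<theta>1 \<mu> :: "('u, 'n cl) form1"
    and B0 B1 \<beta> :: "('u, real) form2"
    and \<Lambda> :: "('u, 'n) ca_section \<Rightarrow> ('u, 'n) ca_section"
  assumes U: "smooth_atlas m \<A>" and C: "C = smooth_functions m \<A>"
    and B: "invariant_form B"
    and g: "g \<in> smooth_maps C spin_group"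
    and A: "A \<in> forms1 C UNIV"
    and \<omega>2: "\<omega>2 \<in> forms2 C UNIV"
    and \<theta>0: "\<theta>0 \<in> forms1 C so_alg" and \<theta>1: "\<theta>1 \<in> forms1 C so_alg"
    and B0: "B0 \<in> forms2 C UNIV" and B1: "B1 \<in> forms2 C UNIV"
    and B01: "B1 - B0 = \<omega>2 + d1 C A"
    and cs: "cs3 C B \<theta>1 - cs3 C B \<theta>0 = d2 C \<omega>2"
    and \<mu>: "\<mu> = pullback1 C g maurer_cartan"
    and \<theta>01: "\<theta>0 - (Ad_map g \<circ> \<theta>1) = - \<mu>"
    and \<beta>: "\<And>X Y x. \<beta> X Y x = (d1 C A + \<omega>2) X Y x
              + B (\<mu> X x) (\<theta>0 Y x) - B (\<mu> Y x) (\<theta>0 X x) - B (\<mu> X x) (\<mu> Y x)"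
    and \<Lambda>: "\<Lambda> = block_matrix (- \<mu>) (Ad_map g) \<beta> (2 * (form_star B \<mu> \<circ> Ad_map g))"
  shows "inner_automorphism C B \<Lambda>"
proof -
  interpret function_algebra C
    unfolding C by (rule function_algebra_smooth_functions)
  interpret spin_gauge C B g
    by unfold_locales (use B g in auto)
  note gauge = \<theta>01[unfolded \<mu>]
  have mu: "\<mu> \<in> forms1 C so_alg"
    unfolding \<mu> by (rule gauge_maurer_cartan_form[OF \<theta>0 \<theta>1 gauge])
  define \<omega> where "\<omega> = (\<omega>2 + d1 C A) + wedge11 B \<mu> \<theta>0"
  \<comment> \<open>That this sum is a 2-form is read off from its equality with
    \<open>B1 - B0\<close>.\<close>
  have \<omega>A: "\<omega>2 + d1 C A \<in> forms2 C UNIV"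
    using forms2_diff[OF B1 B0] B01 by simp
  have wedge: "wedge11 B \<mu> \<theta>0 \<in> forms2 C UNIV"
    by (rule wedge_forms2[OF mu \<theta>0])
  have \<omega>: "\<omega> \<in> forms2 C UNIV"
    unfolding \<omega>_def by (rule forms2_add[OF \<omega>A wedge])
  have d\<omega>: "d2 C \<omega> = d2 C \<omega>2 + d2 C (wedge11 B \<mu> \<theta>0)"
    unfolding \<omega>_def
    by (simp add: d2_add forms2_smooth[OF \<omega>A, simplified] forms2_smooth[OF \<omega>2, simplified] forms2_smooth[OF wedge, simplified]
        d1_smooth[OF A, simplified] d2_d1[OF A])
  have closed: "d2 C \<omega> + pullback3 C g (cartan3 B) = 0"
  proof (intro ext)
    fix X Y Z x
    show "(d2 C \<omega> + pullback3 C g (cartan3 B)) X Y Z x = 0 X Y Z x"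
    proof (cases "X \<in> vector_fields C \<and> Y \<in> vector_fields C \<and> Z \<in> vector_fields C")
      case True
      \<comment> \<open>By \<open>cs\<close>, d\<omega>2 is the difference of the Chern-Simons
        forms, which the transgression formula makes cancel the remaining terms.\<close>
      then show ?thesis
        using chern_simons_gauge[OF \<theta>0 \<theta>1 gauge, of X Y Z x]
        by (simp add: d\<omega> \<mu> flip: cs)
    next
      case False
      then show ?thesis by (auto simp: d2_def pullback3_def)
    qed
  qed
  \<comment> \<open>The two mixed terms of \<beta> form the wedge product inside \<omega>, and its
    last term is the quadratic block.\<close>
  have "\<beta> = \<omega> - (form_star B \<mu> \<circ> \<mu>)"
  proof (intro ext)
    fix X Y x
    have "B (\<mu> Y x) (\<mu> X x) = B (\<mu> X x) (\<mu> Y x)"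
      by (rule form_sym) (rule forms1_mem[OF mu subspace_so_alg])+
    then show "\<beta> X Y x = (\<omega> - (form_star B \<mu> \<circ> \<mu>)) X Y x"
      by (simp add: \<beta> \<omega>_def wedge11_def alt11_def form_star_def)
  qed
  then have \<Lambda>_eq: "\<Lambda> = inner_matrix C B g \<omega>"
    by (simp add: \<Lambda> inner_matrix_def \<mu>)
  show ?thesis
    unfolding inner_automorphism_def \<Lambda>_eq
    using inner_matrix_automorphism[OF mu[unfolded \<mu>] \<omega> closed] g \<omega> closed by blast
qed

end
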